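(* Let $C$ be a conjugation on a Hilbert space $\mathcal H$ and let $V\in\mathbf B(\mathcal H_V,\mathcal H)$ be a $C$-symmetric contraction with $\operatorname{dom}V=\mathcal H_V$ a closed subspace of $\mathcal H$. Let $X_0\in\mathbf B(\mathcal L_0,\mathcal H_V^\perp)$, $\mathcal L_0^\perp$, and $\widetilde V_{\widetilde K}$ be as defined in the context. Then: (1) Each $C$-self-adjoint contractive extension $\widetilde W$ of $V$ on $\mathcal H$ is of the form $$\widetilde W=\tfrac12\left(\widetilde V_{\widetilde K}+C\widetilde V_{\widetilde K}^*C\right),\qquad \widetilde K=\widetilde X^*,\qquad ( * )$$ where $\widetilde X\in\mathbf B(\mathfrak D_{V^*},\mathcal H_V^\perp)$ is a contractive extension of the contraction $X_0$. Conversely, for each contractive extension $\widetilde X\in\mathbf B(\mathfrak D_{V^*},\mathcal H_V^\perp)$ of $X_0$, formula $( * )$ determines a $C$-self-adjoint contractive extension $\widetilde W$ of $V$. (2) Let $\widetilde W_0:=\frac12\left(\widetilde V_{X_0^*}+C\widetilde V_{X_0^*}^*C\right)$ and $\widetilde X_0:=X_0P_{\mathcal L_0}$. Then $$\widetilde W_0=\widetilde V_{X_0^*}+\tfrac12\left(C\widetilde X_0\mathcal D_{V^*}C-CP_{\mathcal H_V^\perp}C\mathcal D_{V^*}X_0^*\right)P_{\mathcal H_V^\perp}$$ $$=VP_{\mathcal H_V}+CV^*CP_{\mathcal H_V^\perp}+\tfrac12\left(CP_{\mathcal H_V^\perp}C\mathcal D_{V^*}X_0^*+C\widetilde X_0\mathcal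 D_{V^*}C\right)P_{\mathcal H_V^\perp}.$$ Moreover, if $\widetilde X=\widetilde K^*$ is written as $\widetilde X=X_0P_{\mathcal L_0}+\mathcal D_{X_0^*}\widetilde YP_{\mathcal L_0^\perp}$ with a contraction $\widetilde Y\in\mathbf B(\mathcal L_0^\perp,\mathfrak D_{X_0^*})$, then the operator $\widetilde W$ in $( * )$ admits the representation $$\widetilde W=\widetilde W_0+\tfrac12\left(M(\widetilde Y^* )+CM(\widetilde Y^* )^*C\right)P_{\mathcal H_V^\perp},$$ where $M(Q):=\mathcal D_{V^*}Q\,\mathcal D_{X_0^*}$ for a contraction $Q\in\mathbf B(\mathfrak D_{X_0^*},\mathcal L_0^\perp)$.
   Context: $\mathbf B(\mathcal H_1,\mathcal H_2)$ denotes the bounded linear operators from $\mathcal H_1$ to $\mathcal H_2$. A conjugation on $\mathcal H$ is an anti-linear isometric operator $C$ on $\mathcal H$ with $C^2=I$. $V$ is $C$-symmetric if $(Vf,Cg)=(f,CVg)$ for all $f,g\in\mathcal H_V$. A bounded operator $B$ on $\mathcal H$ is $C$-self-adjoint if $B=CB^*C$. $\mathcal H_V^\perp:=\mathcal H\ominus\mathcal H_V$, $P_{\mathfrak M}$ is the orthogonal projection onto $\mathfrak M$, and $V^*\in\mathbf B(\mathcal H,\mathcal H_V)$ is the adjoint of $V\in\mathbf B(\mathcal H_V,\mathcal H)$. For a contraction $Z\in\mathbf B(\mathcal H_1,\mathcal H_2)$: $\mathcal D_Z:=(I-Z^*Z)^{1/2}$ and $\mathfrak D_Z:=\overline{\operatorname{ran}}\,\mathcal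 D_Z$; thus $\mathcal D_{V^*}=(I-VV^* )^{1/2}$. The map $\mathcal D_{V^*}Ch\mapsto P_{\mathcal H_V^\perp}CVh$, $h\in\mathcal H_V$, is a well-defined linear contraction; $X_0$ denotes its continuous extension to a contraction $X_0\in\mathbf B(\mathcal L_0,\mathcal H_V^\perp)$, where $\mathcal L_0:=\operatorname{dom}X_0=\overline{\mathcal D_{V^*}C\mathcal H_V}\subseteq\mathfrak D_{V^*}$. Put $\mathcal L_0^\perp:=\mathfrak D_{V^*}\ominus\mathcal L_0=\{y\in\mathfrak D_{V^*}:\mathcal D_{V^*}y\in C\mathcal H_V^\perp\}$ (also written $\mathcal D_{V^*}^{-1}(C\mathcal H_V^\perp)$). $X_0^*\in\mathbf B(\mathcal H_V^\perp,\mathcal L_0)$ is the adjoint of $X_0$. For a contraction $\widetilde K\in\mathbf B(\mathcal H_V^\perp,\mathfrak D_{V^*})$ set $\widetilde V_{\widetilde K}:=VP_{\mathcal H_V}+\mathcal D_{V^*}\widetilde KP_{\mathcal H_V^\perp}$ (a contractive extension of $V$ on $\mathcal H$; in $\widetilde V_{X_0^*}$ the operator $X_0^*$ is regarded as acting into $\mathfrak D_{V^*}$). Contractive extensions $\widetilde X\in\mathbf B(\mathfrak D_{V^*},\mathcal H_V^\perp)$ of $X_0$ are exactly the operators $X_0P_{\mathcal L_0}+\mathcal D_{X_0^*}\widetilde YP_{\mathcal L_0^\perp}$ with $\widetilde Y\in\mathbf B(\mathcal L_0^\perp,\mathfrak D_{X_0^*})$ a contraction. *)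

theory Defs
  imports "HOL-Analysis.Analysis"
begin

text \<open>The inner product is linear in the first argument and conjugate-linear in the second.
  Positivity is implied by the last axiom, since the norm is nonnegative and vanishes only at 0.\<close>

class complex_hilbert = banach +
  fixes scaleC :: "complex \<Rightarrow> 'a \<Rightarrow> 'a"  (infixr "*\<^sub>C" 75)
    and cinner :: "'a \<Rightarrow> 'a \<Rightarrow> complex"
  assumes scaleC_add_right: "c *\<^sub>C (x + y) = c *\<^sub>C x + c *\<^sub>C y"
    and scaleC_add_left: "(b + c) *\<^sub>C x = b *\<^sub>C x + c *\<^sub>C x"
    and scaleC_scaleC: "b *\<^sub>C c *\<^sub>C x = (b * c) *\<^sub>C x"
    and scaleC_of_real: "complex_of_real r *\<^sub>C x = r *\<^sub>R x"
    and cinner_commute: "cinner x y = cnj (cinner y x)"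
    and cinner_add_left: "cinner (x + y) z = cinner x z + cinner y z"
    and cinner_scaleC_left: "cinner (c *\<^sub>C x) y = c * cinner x y"
    and norm_eq_sqrt_cinner: "norm x = sqrt (Re (cinner x x))"

instantiation complex :: complex_hilbert
begin

definition scaleC_complex :: "complex \<Rightarrow> complex \<Rightarrow> complex"
  where "scaleC_complex c x = c * x"

definition cinner_complex :: "complex \<Rightarrow> complex \<Rightarrow> complex"
  where "cinner_complex x y = x * cnj y"

instance
  by standard
    (auto simp: scaleC_complex_def cinner_complex_def algebra_simps scaleR_conv_of_real
      cmod_def power2_eq_square)

end

definition closed_csubspace :: "'a::complex_hilbert set \<Rightarrow> bool"
  where "closed_csubspace M \<longleftrightarrow>
    closed M \<and> 0 \<in> M \<and> (\<forall>x\<in>M. \<forall>y\<in>M. x + y \<in> M) \<and> (\<forall>c. \<forall>x\<in>M. c *\<^sub>C x \<in> M)"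

definition ominus :: "'a::complex_hilbert set \<Rightarrow> 'a set \<Rightarrow> 'a set"  (infixl "\<ominus>\<^sub>H" 65)
  where "N \<ominus>\<^sub>H M = {y \<in> N. \<forall>x\<in>M. cinner y x = 0}"

definition proj :: "'a::complex_hilbert set \<Rightarrow> 'a \<Rightarrow> 'a"
  where "proj M x = (THE y. y \<in> M \<and> x - y \<in> UNIV \<ominus>\<^sub>H M)"

text \<open>An element of \<open>bops M N\<close> represents a bounded linear operator from \<open>M\<close> to \<open>N\<close>.  It is set
  to 0 off its domain \<open>M\<close>, so that each operator has exactly one representative and equality of
  operators is equality of functions.\<close>

definition bops :: "'a::complex_hilbert set \<Rightarrow> 'b::complex_hilbert set \<Rightarrow> ('a \<Rightarrow> 'b) set"
  where "bops M N = {T.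
    (\<forall>x\<in>M. T x \<in> N) \<and> (\<forall>x. x \<notin> M \<longrightarrow> T x = 0) \<and>
    (\<forall>x\<in>M. \<forall>y\<in>M. T (x + y) = T x + T y) \<and> (\<forall>c. \<forall>x\<in>M. T (c *\<^sub>C x) = c *\<^sub>C T x) \<and>
    (\<exists>K. \<forall>x\<in>M. norm (T x) \<le> K * norm x)}"

definition contractions :: "'a::complex_hilbert set \<Rightarrow> 'b::complex_hilbert set \<Rightarrow> ('a \<Rightarrow> 'b) set"
  where "contractions M N = {T \<in> bops M N. \<forall>x\<in>M. norm (T x) \<le> norm x}"

definition extends_on :: "'a set \<Rightarrow> ('a \<Rightarrow> 'b) \<Rightarrow> ('a \<Rightarrow> 'b) \<Rightarrow> bool"
  where "extends_on M T S \<longleftrightarrow> (\<forall>x\<in>M. S x = T x)"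

text \<open>\<open>op_adj M N T\<close> is the adjoint, from \<open>N\<close> to \<open>M\<close>, of \<open>T \<in> bops M N\<close>.\<close>

definition op_adj :: "'a::complex_hilbert set \<Rightarrow> 'b::complex_hilbert set \<Rightarrow> ('a \<Rightarrow> 'b) \<Rightarrow> 'b \<Rightarrow> 'a"
  where "op_adj M N T = (THE S. S \<in> bops N M \<and> (\<forall>x\<in>M. \<forall>y\<in>N. cinner (T x) y = cinner x (S y)))"

definition positive_op :: "'a::complex_hilbert set \<Rightarrow> ('a \<Rightarrow> 'a) \<Rightarrow> bool"
  where "positive_op M S \<longleftrightarrow> (\<forall>x\<in>M. Im (cinner (S x) x) = 0 \<and> 0 \<le> Re (cinner (S x) x))"

definition sqrt_op :: "'a::complex_hilbert set \<Rightarrow> ('a \<Rightarrow> 'a) \<Rightarrow> 'a \<Rightarrow> 'a"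
  where "sqrt_op M A = (THE S. S \<in> bops M M \<and> positive_op M S \<and> (\<forall>x\<in>M. S (S x) = A x))"

text \<open>For a contraction \<open>Z \<in> bops M N\<close>: the operator \<open>(I - Z\<^sup>* Z)\<^sup>1\<^sup>/\<^sup>2\<close> on \<open>M\<close> and the closure of
  its range.\<close>

definition defect :: "'a::complex_hilbert set \<Rightarrow> 'b::complex_hilbert set \<Rightarrow> ('a \<Rightarrow> 'b) \<Rightarrow> 'a \<Rightarrow> 'a"
  where "defect M N Z = sqrt_op M (\<lambda>x. x - op_adj M N Z (Z x))"

definition defect_space :: "'a::complex_hilbert set \<Rightarrow> 'b::complex_hilbert set \<Rightarrow> ('a \<Rightarrow> 'b) \<Rightarrow> 'a set"
  where "defect_space M N Z = closure (defect M N Z ` M)"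

definition conjugation :: "('a::complex_hilbert \<Rightarrow> 'a) \<Rightarrow> bool"
  where "conjugation C \<longleftrightarrow>
    (\<forall>x y. C (x + y) = C x + C y) \<and> (\<forall>c x. C (c *\<^sub>C x) = cnj c *\<^sub>C C x) \<and>
    (\<forall>x. norm (C x) = norm x) \<and> (\<forall>x. C (C x) = x)"

definition C_symmetric :: "('a::complex_hilbert \<Rightarrow> 'a) \<Rightarrow> 'a set \<Rightarrow> ('a \<Rightarrow> 'a) \<Rightarrow> bool"
  where "C_symmetric C HV V \<longleftrightarrow> (\<forall>f\<in>HV. \<forall>g\<in>HV. cinner (V f) (C g) = cinner f (C (V g)))"

definition C_selfadjoint :: "('a::complex_hilbert \<Rightarrow> 'a) \<Rightarrow> ('a \<Rightarrow> 'a) \<Rightarrow> bool"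
  where "C_selfadjoint C B \<longleftrightarrow> B \<in> bops UNIV UNIV \<and> B = C \<circ> op_adj UNIV UNIV B \<circ> C"

definition DVstar :: "'a::complex_hilbert set \<Rightarrow> ('a \<Rightarrow> 'a) \<Rightarrow> 'a \<Rightarrow> 'a"
  where "DVstar HV V = defect UNIV HV (op_adj HV UNIV V)"

definition DVstar_space :: "'a::complex_hilbert set \<Rightarrow> ('a \<Rightarrow> 'a) \<Rightarrow> 'a set"
  where "DVstar_space HV V = defect_space UNIV HV (op_adj HV UNIV V)"

definition L0 :: "('a::complex_hilbert \<Rightarrow> 'a) \<Rightarrow> 'a set \<Rightarrow> ('a \<Rightarrow> 'a) \<Rightarrow> 'a set"
  where "L0 C HV V = closure (DVstar HV V ` C ` HV)"

definition L0_perp :: "('a::complex_hilbert \<Rightarrow> 'a) \<Rightarrow> 'a set \<Rightarrow> ('a \<Rightarrow> 'a) \<Rightarrow> 'a set"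
  where "L0_perp C HV V = DVstar_space HV V \<ominus>\<^sub>H L0 C HV V"

text \<open>A bounded operator on \<open>L0 C HV V\<close> is determined by its values on the dense subspace
  \<open>DVstar HV V ` C ` HV\<close>, so the prescribed values single out the continuous extension.\<close>

definition X0 :: "('a::complex_hilbert \<Rightarrow> 'a) \<Rightarrow> 'a set \<Rightarrow> ('a \<Rightarrow> 'a) \<Rightarrow> 'a \<Rightarrow> 'a"
  where "X0 C HV V = (THE X. X \<in> bops (L0 C HV V) (UNIV \<ominus>\<^sub>H HV) \<and>
    (\<forall>h\<in>HV. X (DVstar HV V (C h)) = proj (UNIV \<ominus>\<^sub>H HV) (C (V h))))"

text \<open>The operator \<open>K\<close> acts from the orthogonal complement of \<open>HV\<close> into \<open>DVstar_space HV V\<close>; since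
  operators are functions on the whole space, no inclusion map is needed if its codomain is smaller.\<close>

definition V_ext :: "'a::complex_hilbert set \<Rightarrow> ('a \<Rightarrow> 'a) \<Rightarrow> ('a \<Rightarrow> 'a) \<Rightarrow> 'a \<Rightarrow> 'a"
  where "V_ext HV V K = (\<lambda>x. V (proj HV x) + DVstar HV V (K (proj (UNIV \<ominus>\<^sub>H HV) x)))"

definition W_ext :: "('a::complex_hilbert \<Rightarrow> 'a) \<Rightarrow> 'a set \<Rightarrow> ('a \<Rightarrow> 'a) \<Rightarrow> ('a \<Rightarrow> 'a) \<Rightarrow> 'a \<Rightarrow> 'a"
  where "W_ext C HV V K =
    (\<lambda>x. (1/2) *\<^sub>R (V_ext HV V K x + C (op_adj UNIV UNIV (V_ext HV V K) (C x))))"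

end

theory Submission
  imports Defs
begin

text \<open>
  The contractive extensions of \<open>V\<close> are governed by their adjoints. If \<open>W\<close> is one of them, then
  the component of \<open>W\<^sup>* x\<close> in \<open>HV\<close> is \<open>V\<^sup>* x\<close>, and what remains of \<open>\<parallel>W\<^sup>* x\<parallel>\<^sup>2 \<le> \<parallel>x\<parallel>\<^sup>2\<close> bounds the
  other component by \<open>\<parallel>D x\<parallel>\<close>, where \<open>D = (I - V V\<^sup>*)\<^sup>1\<^sup>/\<^sup>2\<close>. An operator dominated in this way
  factors through \<open>D\<close> by a contraction (\<open>contraction_factor_exists\<close>), so that
  \<open>W\<^sup>* = V\<^sup>* + Xt D\<close> and \<open>W\<close> is the extension with parameter \<open>K = Xt\<^sup>*\<close>. Conversely, for
  a contraction \<open>Xt\<close> the two orthogonal summands of \<open>V\<^sup>* + Xt D\<close> make it a contraction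
  (\<open>V_ext_props\<close>).

  The conjugation enters through \<open>V\<^sup>* C h = P C V h\<close> for \<open>h\<close> in \<open>HV\<close>, with \<open>P\<close> the projection
  onto \<open>HV\<close>; this is \<open>C\<close>-symmetry (\<open>Vs_C\<close>). Hence \<open>C (V\<^sup>* + Xt D) C\<close> extends \<open>V\<close> if and only if
  \<open>Xt D C h\<close> is the other component of \<open>C V h\<close> for all \<open>h\<close> in \<open>HV\<close>, that is, if and only if
  \<open>Xt\<close> extends \<open>X0\<close>. For such \<open>Xt\<close> the average of \<open>T = V_ext HV V K\<close> and \<open>C T\<^sup>* C\<close> is a
  contractive extension of \<open>V\<close>, and it is \<open>C\<close>-self-adjoint because \<open>B \<mapsto> C B\<^sup>* C\<close> exchanges its two
  terms (\<open>W_ext_props\<close>). A \<open>C\<close>-self-adjoint extension has the form \<open>T\<close> and equals \<open>C T\<^sup>* C\<close>, so it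
  is its own average (\<open>selfadjoint_extension_factor\<close>).

  The explicit formulas follow by writing the average as \<open>V P\<close> plus an expression that is evaluated
  on the orthogonal complement of \<open>HV\<close> and is affine in the pair of \<open>K\<close> and \<open>K\<^sup>*\<close> (\<open>W_ext_formula\<close>). The two
  formulas for \<open>W0\<close> differ by the identity \<open>P C D X0\<^sup>* z = V\<^sup>* C z\<close> (\<open>D_Xs_split\<close>), and the
  parametrisation uses \<open>Xt\<^sup>* = X0\<^sup>* + Yt\<^sup>* DXs\<close>, where \<open>DXs\<close> is the defect operator of \<open>X0\<^sup>*\<close>.

  Projections and adjoints rest on a Riesz representation theorem for closed subspaces, and the
  defect operators on a square root of \<open>I - B\<close> for a self-adjoint contraction \<open>B\<close>, obtained by
  iteration.
\<close>

section \<open>Inner product, projections and adjoints\<close>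

lemma cinner_add_right: "cinner x (y + z) = cinner x y + cinner x z"
  for x :: "'a::complex_hilbert"
  by (metis cinner_add_left cinner_commute complex_cnj_add)

lemma cinner_scaleC_right: "cinner x (c *\<^sub>C y) = cnj c * cinner x y"
  for x :: "'a::complex_hilbert"
  by (metis cinner_scaleC_left cinner_commute complex_cnj_mult)

lemma cinner_scaleR_left: "cinner (r *\<^sub>R x) y = of_real r * cinner x y"
  for x :: "'a::complex_hilbert"
  by (metis cinner_scaleC_left scaleC_of_real)

lemma cinner_scaleR_right: "cinner x (r *\<^sub>R y) = of_real r * cinner x y"
  for x :: "'a::complex_hilbert"
  by (metis cinner_scaleC_right scaleC_of_real complex_cnj_complex_of_real)

lemma cinner_zero_left [simp]: "cinner 0 y = 0" for y :: "'a::complex_hilbert"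
  using cinner_scaleR_left[of 0 0 y] by simp

lemma cinner_zero_right [simp]: "cinner x 0 = 0" for x :: "'a::complex_hilbert"
  using cinner_scaleR_right[of x 0 0] by simp

lemma cinner_minus_left: "cinner (- x) y = - cinner x y" for x :: "'a::complex_hilbert"
  using cinner_scaleR_left[of "-1" x y] by simp

lemma cinner_minus_right: "cinner x (- y) = - cinner x y" for x :: "'a::complex_hilbert"
  using cinner_scaleR_right[of x "-1" y] by simp

lemma cinner_diff_left: "cinner (x - y) z = cinner x z - cinner y z"
  for x :: "'a::complex_hilbert"
  using cinner_add_left[of x "-y" z] by (simp add: cinner_minus_left)

lemma cinner_diff_right: "cinner x (y - z) = cinner x y - cinner x z"
  for x :: "'a::complex_hilbert"
  using cinner_add_right[of x y "-z"] by (simp add: cinner_minus_right)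

lemmas cinner_simps = cinner_add_left cinner_add_right cinner_diff_left cinner_diff_right
  cinner_minus_left cinner_minus_right cinner_scaleC_left cinner_scaleC_right
  cinner_scaleR_left cinner_scaleR_right

lemma scaleC_zero_left [simp]: "0 *\<^sub>C x = 0" for x :: "'a::complex_hilbert"
  using scaleC_of_real[of 0 x] by simp

lemma scaleC_zero_right [simp]: "c *\<^sub>C 0 = 0" for c
  using scaleC_scaleC[of c 0 "0::'a::complex_hilbert"] by simp

lemma scaleC_minus_one: "(-1) *\<^sub>C x = - x" for x :: "'a::complex_hilbert"
  using scaleC_of_real[of "-1" x] by simp

lemma scaleC_diff_right: "c *\<^sub>C (x - y) = c *\<^sub>C x - c *\<^sub>C y" for x :: "'a::complex_hilbert"
  by (metis add_diff_cancel_right' diff_add_cancel scaleC_add_right)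

lemma scaleC_scaleR: "c *\<^sub>C (r *\<^sub>R x) = r *\<^sub>R (c *\<^sub>C x)" for x :: "'a::complex_hilbert"
  by (metis mult.commute scaleC_of_real scaleC_scaleC)

lemma cinner_self_norm: "cinner x x = of_real ((norm x)\<^sup>2)" for x :: "'a::complex_hilbert"
proof -
  have "0 \<le> sqrt (Re (cinner x x))"
    by (metis norm_eq_sqrt_cinner norm_ge_zero)
  then have "(norm x)\<^sup>2 = Re (cinner x x)"
    by (simp add: norm_eq_sqrt_cinner)
  moreover have "Im (cinner x x) = 0"
    using cinner_commute[of x x] by (metis complex_cnj_cancel_iff cnj.simps(2) equal_neg_zero)
  ultimately show ?thesis by (simp add: complex_eq_iff)
qed

lemma norm_sq_cinner: "(norm x)\<^sup>2 = Re (cinner x x)" for x :: "'a::complex_hilbert"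
  by (simp add: cinner_self_norm)

lemma norm_add_sq: "(norm (x + y))\<^sup>2 = (norm x)\<^sup>2 + (norm y)\<^sup>2 + 2 * Re (cinner x y)"
  for x :: "'a::complex_hilbert"
proof -
  have "Re (cinner y x) = Re (cinner x y)"
    by (subst cinner_commute) simp
  then show ?thesis by (simp add: norm_sq_cinner cinner_simps)
qed

lemma norm_add_orthogonal_sq: "cinner x y = 0 \<Longrightarrow> (norm (x + y))\<^sup>2 = (norm x)\<^sup>2 + (norm y)\<^sup>2"
  for x :: "'a::complex_hilbert"
  by (simp add: norm_add_sq)

lemma norm_scaleC: "norm (c *\<^sub>C x) = cmod c * norm x" for x :: "'a::complex_hilbert"
proof -
  have "(norm (c *\<^sub>C x))\<^sup>2 = Re (c * cnj c * cinner x x)"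
    by (simp add: norm_sq_cinner cinner_simps mult_ac)
  also have "\<dots> = (cmod c * norm x)\<^sup>2"
    by (simp add: complex_norm_square[symmetric] cinner_self_norm power_mult_distrib
        del: of_real_power flip: of_real_mult)
  finally show ?thesis
    by (simp add: power2_eq_iff_nonneg)
qed

lemma cauchy_schwarz: "cmod (cinner x y) \<le> norm x * norm y" for x :: "'a::complex_hilbert"
proof (cases "y = 0")
  case False
  define c where "c = cinner x y / of_real ((norm y)\<^sup>2)"
  have ny: "(norm y)\<^sup>2 > 0" using False by simp
  have "0 \<le> (norm (x - c *\<^sub>C y))\<^sup>2" by simp
  also have "\<dots> = (norm x)\<^sup>2 + (cmod c * norm y)\<^sup>2 - 2 * Re (cnj c * cinner x y)"
    using norm_add_sq[of x "- (c *\<^sub>C y)"] by (simp add: norm_scaleC cinner_simps)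
  also have "cnj c * cinner x y = of_real ((cmod (cinner x y))\<^sup>2 / (norm y)\<^sup>2)"
    by (simp add: c_def complex_norm_square[symmetric] mult.commute del: of_real_power)
  also have "(cmod c * norm y)\<^sup>2 = (cmod (cinner x y))\<^sup>2 / (norm y)\<^sup>2"
    using ny by (simp add: c_def norm_divide norm_mult power_mult_distrib power_divide
        power2_eq_square)
  finally have "(cmod (cinner x y))\<^sup>2 / (norm y)\<^sup>2 \<le> (norm x)\<^sup>2"
    by simp
  then have "(cmod (cinner x y))\<^sup>2 \<le> (norm x * norm y)\<^sup>2"
    using ny by (simp add: divide_simps power_mult_distrib)
  then show ?thesis by (rule power2_le_imp_le) simp
qed simp

lemma bounded_bilinear_cinner:
  "bounded_bilinear (cinner :: 'a::complex_hilbert \<Rightarrow> 'a \<Rightarrow> complex)"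
proof
  show "\<exists>K. \<forall>a b :: 'a. norm (cinner a b) \<le> norm a * norm b * K"
    using cauchy_schwarz by (metis mult.right_neutral)
qed (simp_all add: cinner_simps scaleR_conv_of_real)

lemmas tendsto_cinner = bounded_bilinear.tendsto[OF bounded_bilinear_cinner]

lemma bounded_linear_scaleC: "bounded_linear (\<lambda>x :: 'a::complex_hilbert. c *\<^sub>C x)"
  by (rule bounded_linear_intro[where K = "cmod c"])
    (simp_all add: scaleC_add_right scaleC_scaleR norm_scaleC)

lemmas tendsto_scaleC = bounded_linear.tendsto[OF bounded_linear_scaleC]

lemma csubspaceD:
  assumes "closed_csubspace M"
  shows "closed M" "0 \<in> M" "\<And>x y. x \<in> M \<Longrightarrow> y \<in> M \<Longrightarrow> x + y \<in> M"
    "\<And>c x. x \<in> M \<Longrightarrow> c *\<^sub>C x \<in> M" "\<And>x. x \<in> M \<Longrightarrow> - x \<in> M"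
    "\<And>x y. x \<in> M \<Longrightarrow> y \<in> M \<Longrightarrow> x - y \<in> M" "\<And>r x. x \<in> M \<Longrightarrow> r *\<^sub>R x \<in> M"
proof -
  show m: "- x \<in> M" if "x \<in> M" for x
    using assms that unfolding closed_csubspace_def by (metis scaleC_minus_one)
  show "x - y \<in> M" if "x \<in> M" "y \<in> M" for x y
    using assms that m[of y] unfolding closed_csubspace_def
    by (metis add_uminus_conv_diff)
  show "r *\<^sub>R x \<in> M" if "x \<in> M" for r x
    using assms that unfolding closed_csubspace_def by (metis scaleC_of_real)
qed (use assms in \<open>auto simp: closed_csubspace_def\<close>)

lemma csubspace_UNIV [simp]: "closed_csubspace UNIV"
  by (simp add: closed_csubspace_def)

lemma csubspace_closure:
  assumes "0 \<in> S" and add: "\<And>x y. x \<in> S \<Longrightarrow> y \<in> S \<Longrightarrow> x + y \<in> S"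
    and scale: "\<And>c x. x \<in> S \<Longrightarrow> c *\<^sub>C x \<in> S"
  shows "closed_csubspace (closure S)"
  unfolding closed_csubspace_def
proof (intro conjI ballI allI)
  show "closed (closure S)" "0 \<in> closure S"
    using assms(1) closure_subset by auto
  fix x assume x: "x \<in> closure S"
  then obtain f where f: "\<forall>n. f n \<in> S" "f \<longlonglongrightarrow> x" by (auto simp: closure_sequential)
  show "c *\<^sub>C x \<in> closure S" for c
    unfolding closure_sequential
    by (rule exI[of _ "\<lambda>n. c *\<^sub>C f n"]) (use f scale tendsto_scaleC in auto)
  fix y assume "y \<in> closure S"
  then obtain g where g: "\<forall>n. g n \<in> S" "g \<longlonglongrightarrow> y" by (auto simp: closure_sequential)
  show "x + y \<in> closure S"
    unfolding closure_sequential
    by (rule exI[of _ "\<lambda>n. f n + g n"]) (use f g add tendsto_add in auto)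
qed

lemma csubspace_ominus:
  assumes "closed_csubspace N"
  shows "closed_csubspace (N \<ominus>\<^sub>H M)"
  unfolding closed_csubspace_def
proof (intro conjI)
  show "closed (N \<ominus>\<^sub>H M)"
    unfolding closed_sequential_limits
  proof (intro allI impI)
    fix f l assume f: "(\<forall>n. f n \<in> N \<ominus>\<^sub>H M) \<and> f \<longlonglongrightarrow> l"
    then have "l \<in> N"
      using csubspaceD(1)[OF assms] unfolding closed_sequential_limits ominus_def by blast
    moreover have "cinner l x = 0" if "x \<in> M" for x
    proof -
      have "(\<lambda>n. cinner (f n) x) \<longlonglongrightarrow> cinner l x"
        using f by (intro tendsto_cinner) auto
      then show ?thesis using f that by (simp add: ominus_def LIMSEQ_const_iff)
    qed
    ultimately show "l \<in> N \<ominus>\<^sub>H M" by (simp add: ominus_def)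
  qed
qed (use assms in \<open>auto simp: ominus_def cinner_simps closed_csubspace_def\<close>)

text \<open>Stationarity at a minimum, in algebraic form.\<close>

lemma linear_coefficient_zero:
  fixes a c :: real
  assumes nonneg: "\<And>t. 0 \<le> 2 * t * a + t\<^sup>2 * c" and c: "0 \<le> c"
  shows "a = 0"
proof (rule ccontr)
  assume a: "a \<noteq> 0"
  define r where "r = c + 1"
  have r: "r > 0" using c by (simp add: r_def)
  have "2 * (- a / r) * a + (- a / r)\<^sup>2 * c \<le> 2 * (- a / r) * a + (- a / r)\<^sup>2 * r"
    unfolding r_def by (intro add_left_mono mult_left_mono) auto
  also have "\<dots> = - (a\<^sup>2 / r)"
    using r by (simp add: power2_eq_square field_simps)
  also have "\<dots> < 0" using a r by simp
  finally show False using nonneg[of "- a / r"] by simp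
qed

text \<open>The representing vector minimises the functional \<open>y \<mapsto> \<parallel>y\<parallel>\<^sup>2 - 2 Re f(y)\<close>: the parallelogram
  identity makes every minimising sequence Cauchy, and stationarity at the minimum is the
  representation. Applied to \<open>f = (_, x)\<close> on a subspace, the same vector is the projection of \<open>x\<close>.\<close>

lemma riesz_representation:
  fixes M :: "'a::complex_hilbert set"
  assumes M: "closed_csubspace M"
    and add: "\<And>x y. x \<in> M \<Longrightarrow> y \<in> M \<Longrightarrow> f (x + y) = f x + f y"
    and scale: "\<And>c x. x \<in> M \<Longrightarrow> f (c *\<^sub>C x) = c * f x"
    and bound: "\<And>x. x \<in> M \<Longrightarrow> cmod (f x) \<le> K * norm x"
  shows "\<exists>y\<in>M. \<forall>x\<in>M. f x = cinner x y"
proof -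
  note MD = csubspaceD[OF M]
  define J where "J y = (norm y)\<^sup>2 - 2 * Re (f y)" for y
  have scaleR: "f (r *\<^sub>R x) = of_real r * f x" if "x \<in> M" for r x
    using scale[OF that, of "of_real r"] by (simp add: scaleC_of_real)
  have lower: "- K\<^sup>2 \<le> J y" if "y \<in> M" for y
  proof -
    have "Re (f y) \<le> K * norm y"
      using bound[OF that] complex_Re_le_cmod order_trans by blast
    moreover have "0 \<le> (norm y - K)\<^sup>2" by simp
    ultimately show ?thesis unfolding J_def power2_diff by (simp add: algebra_simps)
  qed
  define d where "d = Inf (J ` M)"
  have bdd: "bdd_below (J ` M)" using lower by (intro bdd_belowI[of _ "- K\<^sup>2"]) auto
  have ne: "J ` M \<noteq> {}" using MD(2) by auto
  have dle: "d \<le> J y" if "y \<in> M" for y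
    unfolding d_def using bdd that by (simp add: cInf_lower)
  have "\<exists>y\<in>M. J y < d + 1 / real (Suc n)" for n
    using cInf_less_iff[OF ne bdd, of "d + 1 / real (Suc n)"] by (auto simp: d_def)
  then obtain s where sM: "\<And>n. s n \<in> M" and sJ: "\<And>n. J (s n) < d + 1 / real (Suc n)"
    by metis
  have para: "(norm (a - b))\<^sup>2 = 2 * J a + 2 * J b - 4 * J ((1/2) *\<^sub>R (a + b))"
    if "a \<in> M" "b \<in> M" for a b
  proof -
    have "(norm ((1/2) *\<^sub>R (a + b)))\<^sup>2 = (norm (a + b))\<^sup>2 / 4"
      by (simp add: power_divide)
    moreover have "Re (f ((1/2) *\<^sub>R (a + b))) = (Re (f a) + Re (f b)) / 2"
      using that by (simp add: scaleR MD add)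
    ultimately show ?thesis
      using norm_add_sq[of a b] norm_add_sq[of a "-b"]
      unfolding J_def by (simp add: cinner_simps)
  qed
  have close: "(norm (s m - s n))\<^sup>2 \<le> 4 / real (Suc N)" if "m \<ge> N" "n \<ge> N" for m n N
  proof -
    have "d \<le> J ((1/2) *\<^sub>R (s m + s n))" using sM MD by (intro dle) auto
    moreover have "1 / real (Suc m) \<le> 1 / real (Suc N)" "1 / real (Suc n) \<le> 1 / real (Suc N)"
      using that by (auto simp: frac_le)
    ultimately show ?thesis
      using para[OF sM sM, of m n] sJ[of m] sJ[of n] by simp
  qed
  have "Cauchy s"
  proof (rule metric_CauchyI)
    fix e :: real assume e: "e > 0"
    obtain N where N: "inverse (real (Suc N)) < e\<^sup>2 / 4"
      using reals_Archimedean[of "e\<^sup>2 / 4"] e by auto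
    have "dist (s m) (s n) < e" if "m \<ge> N" "n \<ge> N" for m n
    proof -
      have "(norm (s m - s n))\<^sup>2 < e\<^sup>2"
        by (rule le_less_trans[OF close[OF that]]) (use N in \<open>simp add: field_simps\<close>)
      then show ?thesis using e power2_less_imp_less[of "norm (s m - s n)" e] by (simp add: dist_norm)
    qed
    then show "\<exists>N. \<forall>m\<ge>N. \<forall>n\<ge>N. dist (s m) (s n) < e" by blast
  qed
  then obtain y where y: "s \<longlonglongrightarrow> y" using Cauchy_convergent convergent_def by blast
  have yM: "y \<in> M" using MD(1) sM y closed_sequential_limits by blast
  have f_lim: "(\<lambda>n. f (s n)) \<longlonglongrightarrow> f y"
  proof (rule Lim_null_comparison[THEN LIM_zero_cancel])
    show "\<forall>\<^sub>F n in sequentially. norm (f (s n) - f y) \<le> K * norm (s n - y)"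
    proof (intro always_eventually allI)
      fix n
      have "f (s n) = f (s n - y) + f y"
        using add[of "s n - y" y] sM yM MD by simp
      then show "norm (f (s n) - f y) \<le> K * norm (s n - y)"
        using bound[of "s n - y"] sM yM MD by simp
    qed
    have "(\<lambda>n. norm (s n - y)) \<longlonglongrightarrow> 0" using y by (simp add: LIM_zero tendsto_norm_zero)
    then show "(\<lambda>n. K * norm (s n - y)) \<longlonglongrightarrow> 0" by (rule tendsto_mult_right_zero)
  qed
  have "(\<lambda>n. J (s n)) \<longlonglongrightarrow> J y"
    unfolding J_def by (intro tendsto_intros y f_lim)
  moreover have "(\<lambda>n. d + 1 / real (Suc n)) \<longlonglongrightarrow> d + 0"
    by (intro tendsto_intros LIMSEQ_Suc[OF lim_const_over_n])
  ultimately have Jy: "J y \<le> d"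
    using sJ by (intro LIMSEQ_le[where X = "\<lambda>n. J (s n)" and Y = "\<lambda>n. d + 1 / real (Suc n)"])
      (auto intro: less_imp_le)
  have Re_eq: "Re (f x) = Re (cinner x y)" if x: "x \<in> M" for x
  proof -
    define a where "a = Re (cinner y x) - Re (f x)"
    have *: "0 \<le> 2 * t * a + t\<^sup>2 * (norm x)\<^sup>2" for t
    proof -
      have "J y \<le> J (y + t *\<^sub>R x)"
        using Jy dle[of "y + t *\<^sub>R x"] yM x MD by auto
      then show ?thesis
        using yM x MD
        by (simp add: J_def norm_add_sq add scaleR cinner_simps power_mult_distrib a_def
            algebra_simps)
    qed
    have "a = 0" by (rule linear_coefficient_zero[OF *]) simp
    then show ?thesis unfolding a_def by (subst cinner_commute) simp
  qed
  have "f x = cinner x y" if "x \<in> M" for x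
  proof (rule complex_eqI)
    have "Re (f (\<i> *\<^sub>C x)) = Re (cinner (\<i> *\<^sub>C x) y)"
      using that MD by (intro Re_eq) auto
    then show "Im (f x) = Im (cinner x y)"
      using that by (simp add: scale cinner_simps)
  qed (use Re_eq that in auto)
  then show ?thesis using yM by blast
qed

lemma eq_of_cinner_eq:
  assumes "closed_csubspace M" "a \<in> M" "b \<in> M" "\<And>x. x \<in> M \<Longrightarrow> cinner x a = cinner x b"
  shows "a = b"
proof -
  have "cinner (a - b) (a - b) = 0"
    using assms(4)[of "a - b"] csubspaceD(6)[OF assms(1-3)] by (simp add: cinner_simps)
  then show ?thesis by (simp add: cinner_self_norm)
qed

lemma proj_props:
  assumes M: "closed_csubspace M"
  shows proj_in: "proj M x \<in> M" and proj_cinner: "\<And>m. m \<in> M \<Longrightarrow> cinner m (proj M x) = cinner m x"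
    and proj_eqI: "\<And>y. y \<in> M \<Longrightarrow> (\<And>m. m \<in> M \<Longrightarrow> cinner m y = cinner m x) \<Longrightarrow> proj M x = y"
proof -
  have perp: "x - y \<in> UNIV \<ominus>\<^sub>H M \<longleftrightarrow> (\<forall>m\<in>M. cinner m y = cinner m x)" for y
    unfolding ominus_def mem_Collect_eq
    by (subst cinner_commute) (auto simp: cinner_simps)
  have "\<exists>y\<in>M. \<forall>m\<in>M. cinner m x = cinner m y"
    by (rule riesz_representation[OF M, where K = "norm x"])
      (use cauchy_schwarz in \<open>auto simp: cinner_simps mult.commute\<close>)
  then obtain y where y: "y \<in> M" "\<And>m. m \<in> M \<Longrightarrow> cinner m x = cinner m y" by blast
  have pr: "proj M x = z" if "z \<in> M" "\<And>m. m \<in> M \<Longrightarrow> cinner m z = cinner m x" for z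
    unfolding proj_def
    by (rule the_equality) (use that perp eq_of_cinner_eq[OF M] in auto)
  then show "\<And>y. y \<in> M \<Longrightarrow> (\<And>m. m \<in> M \<Longrightarrow> cinner m y = cinner m x) \<Longrightarrow> proj M x = y" .
  have "proj M x = y" using pr y by auto
  then show "proj M x \<in> M" "\<And>m. m \<in> M \<Longrightarrow> cinner m (proj M x) = cinner m x"
    using y by auto
qed

lemma proj_cinner_left:
  assumes "closed_csubspace M" "m \<in> M"
  shows "cinner (proj M x) m = cinner x m"
  using proj_cinner[OF assms] by (metis cinner_commute)

lemma proj_add:
  assumes M: "closed_csubspace M"
  shows "proj M (x + y) = proj M x + proj M y"
  by (intro proj_eqI[OF M]) (auto simp: proj_in[OF M] proj_cinner[OF M] cinner_simps csubspaceD[OF M])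

lemma proj_scaleC:
  assumes M: "closed_csubspace M"
  shows "proj M (c *\<^sub>C x) = c *\<^sub>C proj M x"
  by (intro proj_eqI[OF M]) (auto simp: proj_in[OF M] proj_cinner[OF M] cinner_simps csubspaceD[OF M])

lemma proj_id:
  assumes "closed_csubspace M" "x \<in> M"
  shows "proj M x = x"
  using assms by (intro proj_eqI) auto

lemma proj_perp:
  assumes "closed_csubspace M" "\<And>m. m \<in> M \<Longrightarrow> cinner m x = 0"
  shows "proj M x = 0"
  using assms by (intro proj_eqI) (auto simp: csubspaceD)

lemma proj_split:
  assumes M: "closed_csubspace M" and N: "closed_csubspace N" and "M \<subseteq> N" and x: "x \<in> N"
  shows "x = proj M x + proj (N \<ominus>\<^sub>H M) x"
proof -
  have "proj (N \<ominus>\<^sub>H M) x = x - proj M x"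
  proof (rule proj_eqI[OF csubspace_ominus[OF N]])
    show "x - proj M x \<in> N \<ominus>\<^sub>H M"
      unfolding ominus_def mem_Collect_eq
    proof (intro conjI ballI)
      show "x - proj M x \<in> N"
        using csubspaceD(6)[OF N x] proj_in[OF M] assms(3) by blast
      show "cinner (x - proj M x) m = 0" if "m \<in> M" for m
        using proj_cinner_left[OF M that] by (simp add: cinner_simps)
    qed
    show "cinner m (x - proj M x) = cinner m x" if "m \<in> N \<ominus>\<^sub>H M" for m
      using that proj_in[OF M] by (simp add: cinner_simps ominus_def)
  qed
  then show ?thesis by simp
qed

lemma ominus_cinner:
  assumes "x \<in> M" "y \<in> N \<ominus>\<^sub>H M"
  shows "cinner x y = 0" "cinner y x = 0"
  using assms by (auto simp: ominus_def cinner_commute[of x y])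

lemma norm_proj_split:
  assumes M: "closed_csubspace M"
  shows "(norm x)\<^sup>2 = (norm (proj M x))\<^sup>2 + (norm (proj (UNIV \<ominus>\<^sub>H M) x))\<^sup>2"
proof -
  have "(norm (proj M x + proj (UNIV \<ominus>\<^sub>H M) x))\<^sup>2
      = (norm (proj M x))\<^sup>2 + (norm (proj (UNIV \<ominus>\<^sub>H M) x))\<^sup>2"
    by (intro norm_add_orthogonal_sq
        ominus_cinner(1)[OF proj_in[OF M] proj_in[OF csubspace_ominus[OF csubspace_UNIV]]])
  then show ?thesis using proj_split[OF M csubspace_UNIV subset_UNIV UNIV_I, of x] by simp
qed

lemma norm_proj_le:
  assumes M: "closed_csubspace M"
  shows "norm (proj M x) \<le> norm x"
  by (rule power2_le_imp_le) (use norm_proj_split[OF M, of x] in auto)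

lemma bopsD:
  assumes "T \<in> bops M N"
  shows "\<And>x. x \<in> M \<Longrightarrow> T x \<in> N" "\<And>x. x \<notin> M \<Longrightarrow> T x = 0"
    "\<And>x y. x \<in> M \<Longrightarrow> y \<in> M \<Longrightarrow> T (x + y) = T x + T y"
    "\<And>c x. x \<in> M \<Longrightarrow> T (c *\<^sub>C x) = c *\<^sub>C T x"
  using assms by (auto simp: bops_def)

lemma bops_bound:
  assumes "T \<in> bops M N"
  obtains K where "K \<ge> 0" "\<And>x. x \<in> M \<Longrightarrow> norm (T x) \<le> K * norm x"
proof -
  obtain K where K: "\<And>x. x \<in> M \<Longrightarrow> norm (T x) \<le> K * norm x"
    using assms unfolding bops_def by blast
  have "norm (T x) \<le> max K 0 * norm x" if "x \<in> M" for x
    using K[OF that] by (smt (verit) mult_right_mono norm_ge_zero)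
  then show thesis using that[of "max K 0"] by simp
qed

lemma bops_linear:
  assumes T: "T \<in> bops M N" and M: "closed_csubspace M"
  shows "T 0 = 0" "\<And>r x. x \<in> M \<Longrightarrow> T (r *\<^sub>R x) = r *\<^sub>R T x"
    "\<And>x y. x \<in> M \<Longrightarrow> y \<in> M \<Longrightarrow> T (x - y) = T x - T y"
proof -
  show "T 0 = 0" using bopsD(4)[OF T csubspaceD(2)[OF M], of 0] by simp
  show "T (x - y) = T x - T y" if "x \<in> M" "y \<in> M" for x y
    using bopsD(3)[OF T _ that(2), of "x - y"] csubspaceD(6)[OF M that]
    by (metis add_diff_cancel_right' diff_add_cancel)
  show "T (r *\<^sub>R x) = r *\<^sub>R T x" if "x \<in> M" for r x
    using bopsD(4)[OF T that, of "of_real r"] by (simp add: scaleC_of_real)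
qed

lemma bops_tendsto:
  assumes T: "T \<in> bops M N" and M: "closed_csubspace M"
    and s: "\<And>n. s n \<in> M" "s \<longlonglongrightarrow> l"
  shows "(\<lambda>n. T (s n)) \<longlonglongrightarrow> T l"
proof -
  have l: "l \<in> M" using s csubspaceD(1)[OF M] closed_sequential_limits by blast
  obtain K where K: "\<And>x. x \<in> M \<Longrightarrow> norm (T x) \<le> K * norm x" using bops_bound[OF T] by metis
  show ?thesis
  proof (rule Lim_null_comparison[THEN LIM_zero_cancel])
    show "\<forall>\<^sub>F n in sequentially. norm (T (s n) - T l) \<le> K * norm (s n - l)"
      using K s(1) l by (simp add: bops_linear(3)[OF T M, symmetric] csubspaceD(6)[OF M])
    have "(\<lambda>n. norm (s n - l)) \<longlonglongrightarrow> 0" using s(2) by (simp add: LIM_zero tendsto_norm_zero)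
    then show "(\<lambda>n. K * norm (s n - l)) \<longlonglongrightarrow> 0" by (rule tendsto_mult_right_zero)
  qed
qed

text \<open>Linearity and boundedness of an adjoint follow from the adjoint relation and the bound on
  \<open>T\<close>, so that a candidate given by a formula needs no separate verification of them.\<close>

lemma adjoint_bounded_operator:
  assumes M: "closed_csubspace M" and N: "closed_csubspace N" and K: "K \<ge> 0"
    and T: "\<And>x. x \<in> M \<Longrightarrow> norm (T x) \<le> K * norm x"
    and S: "\<And>y. y \<in> N \<Longrightarrow> S y \<in> M" "\<And>y. y \<notin> N \<Longrightarrow> S y = 0"
    and adj: "\<And>x y. x \<in> M \<Longrightarrow> y \<in> N \<Longrightarrow> cinner (T x) y = cinner x (S y)"
  shows "S \<in> bops N M" "\<And>y. y \<in> N \<Longrightarrow> norm (S y) \<le> K * norm y"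
proof -
  note MD = csubspaceD[OF M] and ND = csubspaceD[OF N]
  show b: "norm (S y) \<le> K * norm y" if y: "y \<in> N" for y
  proof (cases "S y = 0")
    case False
    have "(norm (S y))\<^sup>2 = Re (cinner (T (S y)) y)"
      using adj[OF S(1) y] y by (simp add: norm_sq_cinner)
    also have "\<dots> \<le> norm (T (S y)) * norm y"
      using complex_Re_le_cmod cauchy_schwarz order_trans by blast
    also have "\<dots> \<le> K * norm (S y) * norm y"
      using T[OF S(1)[OF y]] by (intro mult_right_mono) auto
    finally show ?thesis using False by (simp add: power2_eq_square)
  qed (use K in auto)
  have "S (x + y) = S x + S y" if "x \<in> N" "y \<in> N" for x y
    by (rule eq_of_cinner_eq[OF M])
      (use that in \<open>auto simp: S MD ND cinner_simps adj[symmetric]\<close>)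
  moreover have "S (c *\<^sub>C x) = c *\<^sub>C S x" if "x \<in> N" for c x
    by (rule eq_of_cinner_eq[OF M])
      (use that in \<open>auto simp: S MD ND cinner_simps adj[symmetric]\<close>)
  ultimately show "S \<in> bops N M"
    using S b unfolding bops_def by blast
qed

lemma op_adj_eqI:
  assumes M: "closed_csubspace M" and N: "closed_csubspace N" and T: "T \<in> bops M N"
    and S: "\<And>y. y \<in> N \<Longrightarrow> S y \<in> M" "\<And>y. y \<notin> N \<Longrightarrow> S y = 0"
    and adj: "\<And>x y. x \<in> M \<Longrightarrow> y \<in> N \<Longrightarrow> cinner (T x) y = cinner x (S y)"
  shows "op_adj M N T = S"
  unfolding op_adj_def
proof (rule the_equality)
  obtain K where K: "K \<ge> 0" "\<And>x. x \<in> M \<Longrightarrow> norm (T x) \<le> K * norm x" by (rule bops_bound[OF T]) blast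
  show "S \<in> bops N M \<and> (\<forall>x\<in>M. \<forall>y\<in>N. cinner (T x) y = cinner x (S y))"
    using adjoint_bounded_operator(1)[OF M N K S adj] adj by blast
  fix S' assume S': "S' \<in> bops N M \<and> (\<forall>x\<in>M. \<forall>y\<in>N. cinner (T x) y = cinner x (S' y))"
  show "S' = S"
  proof
    fix y show "S' y = S y"
    proof (cases "y \<in> N")
      case True
      show ?thesis
        by (rule eq_of_cinner_eq[OF M]) (use True S S' adj bopsD(1)[of S' N M y] in auto)
    qed (use S(2) S' bopsD(2)[of S' N M y] in auto)
  qed
qed

lemma op_adj_props:
  assumes M: "closed_csubspace M" and N: "closed_csubspace N" and T: "T \<in> bops M N"
  shows op_adj_bops: "op_adj M N T \<in> bops N M"
    and op_adj_cinner: "\<And>x y. x \<in> M \<Longrightarrow> y \<in> N \<Longrightarrow> cinner (T x) y = cinner x (op_adj M N T y)"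
proof -
  obtain K where K: "K \<ge> 0" "\<And>x. x \<in> M \<Longrightarrow> norm (T x) \<le> K * norm x" by (rule bops_bound[OF T]) blast
  have "\<exists>z\<in>M. \<forall>x\<in>M. cinner (T x) y = cinner x z" for y
  proof (rule riesz_representation[OF M, where K = "K * norm y"])
    show "cmod (cinner (T x) y) \<le> K * norm y * norm x" if "x \<in> M" for x
      using cauchy_schwarz[of "T x" y] mult_right_mono[OF K(2)[OF that], of "norm y"]
      by (simp add: mult_ac)
  qed (auto simp: bopsD[OF T] cinner_simps)
  then obtain S where S: "\<And>y. S y \<in> M" "\<And>x y. x \<in> M \<Longrightarrow> cinner (T x) y = cinner x (S y)"
    by metis
  define S' where "S' y = (if y \<in> N then S y else 0)" for y
  have *: "op_adj M N T = S'"
    by (rule op_adj_eqI[OF M N T]) (auto simp: S'_def S)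
  show "op_adj M N T \<in> bops N M"
    unfolding * by (rule adjoint_bounded_operator(1)[OF M N K]) (auto simp: S'_def S)
  show "\<And>x y. x \<in> M \<Longrightarrow> y \<in> N \<Longrightarrow> cinner (T x) y = cinner x (op_adj M N T y)"
    unfolding * by (auto simp: S'_def S)
qed

lemma op_adj_cinner_left:
  assumes "closed_csubspace M" "closed_csubspace N" "T \<in> bops M N" "x \<in> M" "y \<in> N"
  shows "cinner (op_adj M N T y) x = cinner y (T x)"
  using op_adj_cinner[OF assms] by (metis cinner_commute)

lemma op_adj_op_adj:
  assumes M: "closed_csubspace M" and N: "closed_csubspace N" and T: "T \<in> bops M N"
  shows "op_adj N M (op_adj M N T) = T"
  by (rule op_adj_eqI[OF N M op_adj_bops[OF M N T]])
    (auto simp: bopsD[OF T] op_adj_cinner_left[OF M N T])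

lemma contractionsD:
  assumes "T \<in> contractions M N"
  shows "T \<in> bops M N" "\<And>x. x \<in> M \<Longrightarrow> norm (T x) \<le> norm x"
  using assms by (auto simp: contractions_def)

lemma op_adj_contraction:
  assumes M: "closed_csubspace M" and N: "closed_csubspace N" and T: "T \<in> contractions M N"
  shows "op_adj M N T \<in> contractions N M"
proof -
  note A = op_adj_props[OF M N contractionsD(1)[OF T]]
  have "norm (op_adj M N T y) \<le> 1 * norm y" if "y \<in> N" for y
    by (rule adjoint_bounded_operator(2)[OF M N _ _ _ _ A(2)])
      (use that contractionsD(2)[OF T] bopsD[OF A(1)] in auto)
  then show ?thesis using A by (simp add: contractions_def)
qed

text \<open>For operators such as \<open>V_ext\<close> below the norm of the adjoint is the one that is easy to
  bound.\<close>

lemma contraction_from_adjoint: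
  assumes M: "closed_csubspace M" and N: "closed_csubspace N"
    and T: "\<And>x. x \<in> M \<Longrightarrow> norm (T x) \<le> norm x"
    and S: "\<And>y. y \<in> N \<Longrightarrow> S y \<in> M" "\<And>y. y \<notin> N \<Longrightarrow> S y = 0"
    and adj: "\<And>x y. x \<in> M \<Longrightarrow> y \<in> N \<Longrightarrow> cinner (T x) y = cinner x (S y)"
  shows "S \<in> contractions N M"
  using adjoint_bounded_operator[OF M N zero_le_one _ S adj] T by (simp add: contractions_def)

section \<open>Positive square roots and defect operators\<close>

text \<open>Polarisation: the form of \<open>S\<close> is real on \<open>x + y\<close> and on \<open>x + \<i> y\<close>.\<close>

lemma positive_op_selfadjoint:
  assumes M: "closed_csubspace M" and S: "S \<in> bops M M" and pos: "positive_op M S"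
    and x: "x \<in> M" and y: "y \<in> M"
  shows "cinner (S x) y = cinner x (S y)"
proof -
  have im: "Im (cinner (S u) u) = 0" if "u \<in> M" for u
    using pos that by (simp add: positive_op_def)
  note MD = csubspaceD[OF M] and SD = bopsD[OF S]
  have 1: "Im (cinner (S x) y) = - Im (cinner (S y) x)"
    using im[of "x + y"] im[of x] im[of y] x y by (simp add: SD MD cinner_simps)
  have 2: "Re (cinner (S x) y) = Re (cinner (S y) x)"
    using im[of "x + \<i> *\<^sub>C y"] im[of x] im[of y] x y by (simp add: SD MD cinner_simps)
  have "cinner (S x) y = cnj (cinner (S y) x)"
    using 1 2 by (simp add: complex_eq_iff)
  then show ?thesis by (metis cinner_commute)
qed

text \<open>A positive form vanishing at \<open>y\<close> is minimal there, hence stationary, in particular in the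
  direction \<open>S y\<close>.\<close>

lemma positive_op_kernel:
  assumes M: "closed_csubspace M" and S: "S \<in> bops M M" and pos: "positive_op M S"
    and y: "y \<in> M" and zero: "Re (cinner (S y) y) = 0"
  shows "S y = 0"
proof -
  note MD = csubspaceD[OF M] and SD = bopsD[OF S] and SL = bops_linear[OF S M]
  define a where "a = (norm (S y))\<^sup>2"
  define c where "c = Re (cinner (S (S y)) (S y))"
  have c: "0 \<le> c" using pos y SD(1) by (auto simp: positive_op_def c_def)
  have Sy: "S y \<in> M" using SD(1) y .
  have "cinner (S (S y)) y = cinner (S y) (S y)"
    by (rule positive_op_selfadjoint[OF M S pos Sy y])
  then have *: "0 \<le> 2 * t * a + t\<^sup>2 * c" for t
  proof -
    have "y + t *\<^sub>R S y \<in> M" using y Sy MD by auto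
    then have "0 \<le> Re (cinner (S (y + t *\<^sub>R S y)) (y + t *\<^sub>R S y))"
      using pos by (simp add: positive_op_def)
    also have "\<dots> = 2 * t * a + t\<^sup>2 * c"
      unfolding a_def c_def norm_sq_cinner
      using \<open>cinner (S (S y)) y = cinner (S y) (S y)\<close> zero y Sy
      by (simp add: SD SL MD cinner_simps power2_eq_square
          algebra_simps)
    finally show ?thesis .
  qed
  have "a = 0" by (rule linear_coefficient_zero[OF * c])
  then show ?thesis by (simp add: a_def)
qed

text \<open>The square root of \<open>I - B\<close> is sought as \<open>I - Y\<close>, so that \<open>Y = (B + Y\<^sup>2) / 2\<close>; the iteration
  below solves this equation. Its steps are dominated by those of the same iteration for the
  number \<open>B = 1\<close>, which increases and is bounded by \<open>1\<close>, and this gives convergence.\<close>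

primrec root_iter :: "('a::complex_hilbert \<Rightarrow> 'a) \<Rightarrow> nat \<Rightarrow> 'a \<Rightarrow> 'a" where
  "root_iter B 0 = (\<lambda>x. 0)"
| "root_iter B (Suc n) = (\<lambda>x. (1/2) *\<^sub>R (B x + root_iter B n (root_iter B n x)))"

primrec root_bound :: "nat \<Rightarrow> real" where
  "root_bound 0 = 0"
| "root_bound (Suc n) = (1 + (root_bound n)\<^sup>2) / 2"

lemma root_bound_range: "0 \<le> root_bound n" "root_bound n \<le> 1"
proof -
  have "0 \<le> root_bound n \<and> root_bound n \<le> 1"
    by (induction n) (auto simp: power_le_one)
  then show "0 \<le> root_bound n" "root_bound n \<le> 1" by auto
qed

lemma root_bound_Suc: "root_bound n \<le> root_bound (Suc n)"
proof -
  have "0 \<le> (1 - root_bound n)\<^sup>2" by simp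
  then show ?thesis by (simp add: power2_diff)
qed

lemma Cauchy_root_bound: "Cauchy root_bound"
proof (intro convergent_Cauchy Bseq_monoseq_convergent)
  show "Bseq root_bound"
    by (rule BseqI'[of _ 1]) (use root_bound_range in auto)
  show "monoseq root_bound"
    using root_bound_Suc by (auto simp: monoseq_Suc)
qed

context
  fixes M :: "'a::complex_hilbert set" and B :: "'a \<Rightarrow> 'a"
  assumes M: "closed_csubspace M" and B: "B \<in> contractions M M"
begin

lemma root_iter_in: "x \<in> M \<Longrightarrow> root_iter B n x \<in> M"
  using csubspaceD[OF M] bopsD(1)[OF contractionsD(1)[OF B]] by (induction n arbitrary: x) auto

lemma root_iter_bound: "x \<in> M \<Longrightarrow> norm (root_iter B n x) \<le> root_bound n * norm x"
proof (induction n arbitrary: x)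
  case (Suc n)
  have "norm (root_iter B n (root_iter B n x)) \<le> root_bound n * norm (root_iter B n x)"
    by (rule Suc.IH[OF root_iter_in[OF Suc.prems]])
  also have "\<dots> \<le> root_bound n * (root_bound n * norm x)"
    by (intro mult_left_mono Suc root_bound_range)
  finally have "norm (B x + root_iter B n (root_iter B n x))
      \<le> norm x + root_bound n * (root_bound n * norm x)"
    using norm_triangle_ineq[of "B x" "root_iter B n (root_iter B n x)"]
      contractionsD(2)[OF B Suc.prems] by linarith
  moreover have "norm (root_iter B (Suc n) x)
      = (1/2) * norm (B x + root_iter B n (root_iter B n x))"
    by (simp only: root_iter.simps norm_scaleR)
  ultimately show ?case by (simp add: power2_eq_square algebra_simps)
qed simp

lemma root_iter_commute:
  assumes T: "T \<in> bops M M" and comm: "\<And>x. x \<in> M \<Longrightarrow> T (B x) = B (T x)"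
  shows "x \<in> M \<Longrightarrow> T (root_iter B n x) = root_iter B n (T x)"
proof (induction n arbitrary: x)
  case (Suc n)
  have "B x \<in> M" using bopsD(1)[OF contractionsD(1)[OF B] Suc.prems] .
  then show ?case
    using Suc root_iter_in[OF Suc.prems] root_iter_in[OF root_iter_in[OF Suc.prems]]
    by (simp add: bopsD[OF T] bops_linear[OF T M] csubspaceD[OF M] comm)
qed (simp add: bops_linear[OF T M])

lemma root_iter_bops: "root_iter B n \<in> bops M M"
proof (induction n)
  case 0
  show ?case using csubspaceD[OF M] by (auto simp: bops_def intro!: exI[of _ 0])
next
  case (Suc n)
  note BD = bopsD[OF contractionsD(1)[OF B]] and YD = bopsD[OF Suc]
    and YL = bops_linear[OF Suc M]
  have "norm (root_iter B (Suc n) x) \<le> root_bound (Suc n) * norm x" if "x \<in> M" for x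
    by (rule root_iter_bound[OF that])
  then have "\<exists>K. \<forall>x\<in>M. norm (root_iter B (Suc n) x) \<le> K * norm x" by blast
  moreover have "root_iter B (Suc n) x \<in> M" if "x \<in> M" for x
    by (rule root_iter_in[OF that])
  ultimately show ?case
    unfolding bops_def mem_Collect_eq
    by (auto simp: BD YD YL scaleC_scaleR scaleC_add_right scaleR_add_right)
qed

text \<open>With \<open>Y\<close> and \<open>Z\<close> consecutive iterates, \<open>Z\<^sup>2 - Y\<^sup>2 = (Z - Y) (Z + Y)\<close>, since the iterates
  commute with each other.\<close>

lemma root_iter_step:
  "x \<in> M \<Longrightarrow> norm (root_iter B (Suc n) x - root_iter B n x)
      \<le> (root_bound (Suc n) - root_bound n) * norm x"
proof (induction n arbitrary: x)
  case 0
  show ?case using contractionsD(2)[OF B 0] by simp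
next
  case (Suc n)
  define Y Z where "Y = root_iter B n" and "Z = root_iter B (Suc n)"
  define y z where "y = root_bound n" and "z = root_bound (Suc n)"
  note x = Suc.prems
  note YD = bopsD[OF root_iter_bops[of n], folded Y_def]
    and ZD = bopsD[OF root_iter_bops[of "Suc n"], folded Z_def]
  have comm: "Y (Z x) = Z (Y x)"
    unfolding Y_def Z_def
    by (intro root_iter_commute[OF root_iter_bops _ x]
        root_iter_commute[OF contractionsD(1)[OF B], symmetric]) auto
  define u where "u = Z x + Y x"
  have u: "u \<in> M"
    unfolding u_def by (intro csubspaceD(3)[OF M] ZD(1) YD(1) x)
  have Zx: "Z x = (1/2) *\<^sub>R (B x + Y (Y x))"
    by (simp only: Z_def Y_def root_iter.simps(2))
  have Zx_next: "root_iter B (Suc (Suc n)) x = (1/2) *\<^sub>R (B x + Z (Z x))"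
    by (simp only: Z_def root_iter.simps(2)[of B "Suc n"])
  have "root_iter B (Suc (Suc n)) x - Z x
      = (1/2) *\<^sub>R (B x + Z (Z x)) - (1/2) *\<^sub>R (B x + Y (Y x))"
    by (rule arg_cong2[OF Zx_next Zx])
  also have "\<dots> = (1/2) *\<^sub>R (Z u - Y u)"
    using x YD(1) ZD(1) by (simp add: u_def YD(3) ZD(3) comm algebra_simps)
  finally have "norm (root_iter B (Suc (Suc n)) x - Z x) = (1/2) * norm (Z u - Y u)"
    by simp
  also have "\<dots> \<le> (1/2) * ((z - y) * norm u)"
    using Suc.IH[OF u] unfolding Y_def Z_def y_def z_def by (intro mult_left_mono) auto
  also have "\<dots> \<le> (1/2) * ((z - y) * ((z + y) * norm x))"
  proof (intro mult_left_mono)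
    show "norm u \<le> (z + y) * norm x"
      using norm_triangle_ineq[of "Z x" "Y x"] root_iter_bound[OF x, of n]
        root_iter_bound[OF x, of "Suc n"]
      unfolding u_def Y_def Z_def y_def z_def distrib_right by linarith
  qed (use root_bound_Suc[of n] in \<open>auto simp: y_def z_def\<close>)
  also have "\<dots> = (root_bound (Suc (Suc n)) - z) * norm x"
  proof -
    have "root_bound (Suc (Suc n)) - z = (1 + z\<^sup>2) / 2 - (1 + y\<^sup>2) / 2"
      by (simp add: z_def y_def)
    also have "\<dots> = (z - y) * (z + y) / 2"
      by (simp add: power2_eq_square field_simps)
    finally have "root_bound (Suc (Suc n)) - z = (z - y) * (z + y) / 2" .
    then show ?thesis by (simp del: root_bound.simps)
  qed
  finally show ?case by (simp only: Z_def z_def)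
qed

lemma root_iter_Cauchy:
  assumes x: "x \<in> M"
  shows "Cauchy (\<lambda>n. root_iter B n x)"
proof (rule metric_CauchyI)
  have le: "norm (root_iter B (n + k) x - root_iter B n x)
      \<le> (root_bound (n + k) - root_bound n) * norm x" for n k
  proof (induction k)
    case (Suc k)
    have "norm (root_iter B (n + Suc k) x - root_iter B n x)
        \<le> norm (root_iter B (Suc (n + k)) x - root_iter B (n + k) x)
          + norm (root_iter B (n + k) x - root_iter B n x)"
      by (metis add_Suc_right norm_diff_triangle_le order_refl)
    also have "\<dots> \<le> (root_bound (Suc (n + k)) - root_bound (n + k)) * norm x
        + (root_bound (n + k) - root_bound n) * norm x"
      by (intro add_mono root_iter_step x Suc)
    finally show ?case by (simp add: left_diff_distrib)
  qed simp
  fix e :: real assume e: "e > 0"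
  define e' where "e' = e / (norm x + 1)"
  have nx: "norm x + 1 > 0" by (simp add: add_nonneg_pos)
  then have "e' > 0" using e by (simp add: e'_def)
  then obtain N where N: "\<And>m n. m \<ge> N \<Longrightarrow> n \<ge> N \<Longrightarrow> dist (root_bound m) (root_bound n) < e'"
    using Cauchy_root_bound metric_CauchyD by blast
  have *: "dist (root_iter B m x) (root_iter B n x) < e" if "m \<ge> n" "n \<ge> N" for m n
  proof -
    have "norm (root_iter B m x - root_iter B n x) \<le> (root_bound m - root_bound n) * norm x"
      using le[of n "m - n"] that by simp
    also have "\<dots> \<le> e' * norm x"
      using N[of m n] that by (intro mult_right_mono) (auto simp: dist_real_def)
    also have "\<dots> < e' * (norm x + 1)" using \<open>e' > 0\<close> by simp
    also have "\<dots> = e" using nx by (simp add: e'_def)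
    finally show ?thesis by (simp add: dist_norm)
  qed
  show "\<exists>N. \<forall>m\<ge>N. \<forall>n\<ge>N. dist (root_iter B m x) (root_iter B n x) < e"
    by (rule exI[of _ N]) (metis * dist_commute nle_le)
qed

text \<open>Being a strong limit of polynomials in \<open>B\<close>, the root commutes with everything that commutes
  with \<open>B\<close>; uniqueness of the positive root below depends on this.\<close>

lemma commuting_positive_root_exists:
  assumes selfadj: "\<And>x y. x \<in> M \<Longrightarrow> y \<in> M \<Longrightarrow> cinner (B x) y = cinner x (B y)"
  shows "\<exists>S \<in> bops M M. positive_op M S \<and> (\<forall>x\<in>M. S (S x) = x - B x) \<and>
    (\<forall>T \<in> bops M M. (\<forall>x\<in>M. T (B x) = B (T x)) \<longrightarrow> (\<forall>x\<in>M. T (S x) = S (T x)))"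
proof -
  note MD = csubspaceD[OF M] and RD = bopsD[OF root_iter_bops] and RL = bops_linear[OF root_iter_bops M]
  define Y where "Y x = lim (\<lambda>n. root_iter B n x)" for x
  have lim: "(\<lambda>n. root_iter B n x) \<longlonglongrightarrow> Y x" if "x \<in> M" for x
    using root_iter_Cauchy[OF that] unfolding Y_def
    by (simp add: Cauchy_convergent_iff convergent_LIMSEQ_iff)
  have YM: "Y x \<in> M" if "x \<in> M" for x
    by (rule closed_sequentially[OF MD(1) root_iter_in[OF that] lim[OF that]])
  have le1: "norm (root_iter B n x) \<le> norm x" if "x \<in> M" for n x
    using root_iter_bound[OF that, of n] root_bound_range[of n]
    by (smt (verit) mult_left_le_one_le norm_ge_zero)
  have Yle: "norm (Y x) \<le> norm x" if "x \<in> M" for x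
    using tendsto_norm[OF lim[OF that]] le1[OF that]
    by (intro LIMSEQ_le_const2[where X = "\<lambda>n. norm (root_iter B n x)"]) auto
  have Yadd: "Y (x + y) = Y x + Y y" if "x \<in> M" "y \<in> M" for x y
  proof (rule LIMSEQ_unique)
    show "(\<lambda>n. root_iter B n (x + y)) \<longlonglongrightarrow> Y (x + y)" using that MD by (intro lim) auto
    show "(\<lambda>n. root_iter B n (x + y)) \<longlonglongrightarrow> Y x + Y y"
      using tendsto_add[OF lim[OF that(1)] lim[OF that(2)]] that by (simp add: RD)
  qed
  have Yscale: "Y (c *\<^sub>C x) = c *\<^sub>C Y x" if "x \<in> M" for c x
  proof (rule LIMSEQ_unique)
    show "(\<lambda>n. root_iter B n (c *\<^sub>C x)) \<longlonglongrightarrow> Y (c *\<^sub>C x)" using that MD by (intro lim) auto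
    show "(\<lambda>n. root_iter B n (c *\<^sub>C x)) \<longlonglongrightarrow> c *\<^sub>C Y x"
      using tendsto_scaleC[OF lim[OF that]] that by (simp add: RD)
  qed
  have Ydiff: "Y (x - y) = Y x - Y y" if "x \<in> M" "y \<in> M" for x y
    using Yadd[of "x - y" y] that MD by simp
  have Yfix: "Y x = (1/2) *\<^sub>R (B x + Y (Y x))" if x: "x \<in> M" for x
  proof (rule LIMSEQ_unique)
    show "(\<lambda>n. root_iter B (Suc n) x) \<longlonglongrightarrow> Y x"
      by (rule LIMSEQ_Suc[OF lim[OF x]])
    have "(\<lambda>n. root_iter B n (root_iter B n x - Y x)) \<longlonglongrightarrow> 0"
    proof (rule Lim_null_comparison)
      show "\<forall>\<^sub>F n in sequentially.
          norm (root_iter B n (root_iter B n x - Y x)) \<le> norm (root_iter B n x - Y x)"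
        using le1 MD(6)[OF root_iter_in[OF x] YM[OF x]] by simp
      show "(\<lambda>n. norm (root_iter B n x - Y x)) \<longlonglongrightarrow> 0"
        using lim[OF x] by (simp add: LIM_zero tendsto_norm_zero)
    qed
    from tendsto_add[OF this lim[OF YM[OF x]]]
    have "(\<lambda>n. root_iter B n (root_iter B n x)) \<longlonglongrightarrow> Y (Y x)"
      using root_iter_in[OF x] YM[OF x] by (simp add: RL)
    then show "(\<lambda>n. root_iter B (Suc n) x) \<longlonglongrightarrow> (1/2) *\<^sub>R (B x + Y (Y x))"
      unfolding root_iter.simps(2) by (intro tendsto_intros)
  qed
  have iter_selfadj: "cinner (root_iter B n x) y = cinner x (root_iter B n y)"
    if "x \<in> M" "y \<in> M" for n x y
    using that
  proof (induction n arbitrary: x y)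
    case (Suc n)
    then show ?case using root_iter_in by (simp add: cinner_simps selfadj)
  qed simp
  have Yselfadj: "cinner (Y x) y = cinner x (Y y)" if "x \<in> M" "y \<in> M" for x y
  proof (rule LIMSEQ_unique)
    show "(\<lambda>n. cinner (root_iter B n x) y) \<longlonglongrightarrow> cinner (Y x) y"
      by (intro tendsto_cinner lim that tendsto_const)
    show "(\<lambda>n. cinner (root_iter B n x) y) \<longlonglongrightarrow> cinner x (Y y)"
      unfolding iter_selfadj[OF that] by (intro tendsto_cinner lim that tendsto_const)
  qed
  define S where "S x = (if x \<in> M then x - Y x else 0)" for x
  have "norm (S x) \<le> 2 * norm x" if "x \<in> M" for x
    using norm_triangle_ineq4[of x "Y x"] Yle[OF that] that by (simp add: S_def)
  then have "\<exists>K. \<forall>x\<in>M. norm (S x) \<le> K * norm x" by blast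
  then have S: "S \<in> bops M M"
    by (auto simp: bops_def S_def MD YM Yadd Yscale scaleC_diff_right)
  have "positive_op M S"
    unfolding positive_op_def
  proof (intro ballI conjI)
    fix x assume x: "x \<in> M"
    have "cinner (Y x) x = cnj (cinner (Y x) x)"
      using Yselfadj[OF x x] by (metis cinner_commute)
    then have "Im (cinner (Y x) x) = 0"
      by (metis cnj.simps(2) equal_neg_zero)
    then show "Im (cinner (S x) x) = 0"
      using x by (simp add: S_def cinner_simps cinner_self_norm)
    have "Re (cinner (Y x) x) \<le> norm (Y x) * norm x"
      using complex_Re_le_cmod cauchy_schwarz order_trans by blast
    also have "\<dots> \<le> norm x * norm x"
      by (intro mult_right_mono Yle x) simp
    finally show "0 \<le> Re (cinner (S x) x)"
      using x by (simp add: S_def cinner_simps norm_sq_cinner[symmetric] power2_eq_square)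
  qed
  moreover have "S (S x) = x - B x" if x: "x \<in> M" for x
  proof -
    have "S (S x) = x - Y x - (Y x - Y (Y x))"
      using x by (simp add: S_def MD YM Ydiff)
    also have "\<dots> = x - 2 *\<^sub>R Y x + Y (Y x)" by (simp add: scaleR_2)
    also have "\<dots> = x - B x" by (subst (1) Yfix[OF x]) simp
    finally show ?thesis .
  qed
  moreover have "T (S x) = S (T x)"
    if T: "T \<in> bops M M" and comm: "\<forall>x\<in>M. T (B x) = B (T x)" and x: "x \<in> M" for T x
  proof -
    have Tx: "T x \<in> M" using bopsD(1)[OF T x] .
    have "T (Y x) = Y (T x)"
    proof (rule LIMSEQ_unique)
      show "(\<lambda>n. T (root_iter B n x)) \<longlonglongrightarrow> T (Y x)"
        by (rule bops_tendsto[OF T M root_iter_in[OF x] lim[OF x]])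
      show "(\<lambda>n. T (root_iter B n x)) \<longlonglongrightarrow> Y (T x)"
        using lim[OF Tx] root_iter_commute[OF T _ x] comm by simp
    qed
    then show ?thesis using x Tx YM[OF x] by (simp add: S_def bops_linear[OF T M])
  qed
  ultimately show ?thesis using S by blast
qed

end

text \<open>For \<open>y\<close> in the range of \<open>S - T\<close>, \<open>(S + T) y = 0\<close>, so both positive forms vanish at \<open>y\<close> and
  therefore \<open>S y = T y = 0\<close>, which gives \<open>\<parallel>S x - T x\<parallel>\<^sup>2 = (x, (S - T) y) = 0\<close> for
  \<open>y = S x - T x\<close>.\<close>

lemma commuting_positive_root_unique:
  assumes M: "closed_csubspace M"
    and S: "S \<in> bops M M" "positive_op M S" and T: "T \<in> bops M M" "positive_op M T"
    and comm: "\<And>x. x \<in> M \<Longrightarrow> T (S x) = S (T x)"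
    and sq: "\<And>x. x \<in> M \<Longrightarrow> S (S x) = T (T x)"
  shows "S = T"
proof
  fix x show "S x = T x"
  proof (cases "x \<in> M")
    case x: True
    define y where "y = S x - T x"
    have Sx: "S x \<in> M" and Tx: "T x \<in> M" using bopsD(1) S T x by blast+
    then have y: "y \<in> M" unfolding y_def using csubspaceD(6)[OF M] by blast
    have "S y + T y = 0"
      using Sx Tx x
      by (simp add: y_def bops_linear[OF S(1) M] bops_linear[OF T(1) M] comm sq)
    then have "Re (cinner (S y) y) + Re (cinner (T y) y) = 0"
      by (metis cinner_add_left cinner_zero_left plus_complex.simps(1) zero_complex.simps(1))
    moreover have "0 \<le> Re (cinner (S y) y)" "0 \<le> Re (cinner (T y) y)"
      using S T y by (auto simp: positive_op_def)
    ultimately have "Re (cinner (S y) y) = 0" "Re (cinner (T y) y) = 0" by auto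
    then have "S y = 0" "T y = 0"
      using positive_op_kernel[OF M] S T y by blast+
    moreover have "cinner y y = cinner x (S y) - cinner x (T y)"
      by (subst (1) y_def)
        (simp add: cinner_diff_left positive_op_selfadjoint[OF M S x y]
          positive_op_selfadjoint[OF M T x y])
    ultimately have "cinner y y = 0" by simp
    then show ?thesis by (simp add: cinner_self_norm y_def)
  qed (use bopsD(2) S T in metis)
qed

lemma sqrt_op_props:
  assumes M: "closed_csubspace M" and B: "B \<in> contractions M M"
    and selfadj: "\<And>x y. x \<in> M \<Longrightarrow> y \<in> M \<Longrightarrow> cinner (B x) y = cinner x (B y)"
  shows "sqrt_op M (\<lambda>x. x - B x) \<in> bops M M \<and> positive_op M (sqrt_op M (\<lambda>x. x - B x)) \<and>
    (\<forall>x\<in>M. sqrt_op M (\<lambda>x. x - B x) (sqrt_op M (\<lambda>x. x - B x) x) = x - B x)"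
proof -
  obtain S where S: "S \<in> bops M M" "positive_op M S" and sq: "\<forall>x\<in>M. S (S x) = x - B x"
    and comm: "\<And>T. T \<in> bops M M \<Longrightarrow> \<forall>x\<in>M. T (B x) = B (T x) \<Longrightarrow> \<forall>x\<in>M. T (S x) = S (T x)"
    using commuting_positive_root_exists[OF M B selfadj] by blast
  have "sqrt_op M (\<lambda>x. x - B x) = S"
    unfolding sqrt_op_def
  proof (rule the_equality)
    fix T assume T: "T \<in> bops M M \<and> positive_op M T \<and> (\<forall>x\<in>M. T (T x) = x - B x)"
    have "T (B x) = B (T x)" if x: "x \<in> M" for x
    proof -
      have Tx: "T x \<in> M" "T (T x) \<in> M" using T bopsD(1) x by blast+
      have "B x = x - T (T x)" using T x by auto
      then have "T (B x) = T x - T (T (T x))"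
        using bops_linear(3)[of T M M x "T (T x)"] T M x Tx by simp
      also have "\<dots> = B (T x)" using T Tx by auto
      finally show ?thesis .
    qed
    then have "S = T"
      using T sq comm[of T] by (intro commuting_positive_root_unique[OF M S]) auto
    then show "T = S" ..
  qed (use S sq in auto)
  then show ?thesis using S sq by auto
qed

lemma defect_props:
  fixes Z :: "'a::complex_hilbert \<Rightarrow> 'b::complex_hilbert"
  assumes M: "closed_csubspace M" and N: "closed_csubspace N" and Z: "Z \<in> contractions M N"
  shows defect_bops: "defect M N Z \<in> bops M M"
    and defect_selfadjoint: "\<And>x y. x \<in> M \<Longrightarrow> y \<in> M \<Longrightarrow>
      cinner (defect M N Z x) y = cinner x (defect M N Z y)"
    and norm_defect: "\<And>x. x \<in> M \<Longrightarrow> (norm (defect M N Z x))\<^sup>2 = (norm x)\<^sup>2 - (norm (Z x))\<^sup>2"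
proof -
  note Zb = contractionsD(1)[OF Z]
  have Zs: "op_adj M N Z \<in> contractions N M" by (rule op_adj_contraction[OF M N Z])
  define B where "B x = op_adj M N Z (Z x)" for x
  have selfadj: "cinner (B x) y = cinner x (B y)" if "x \<in> M" "y \<in> M" for x y
    using that op_adj_cinner[OF M N Zb that(1) bopsD(1)[OF Zb that(2)]]
      op_adj_cinner_left[OF M N Zb that(2) bopsD(1)[OF Zb that(1)]] by (simp add: B_def)
  have "B \<in> contractions M M"
  proof (rule contraction_from_adjoint[OF M M])
    show "norm (B x) \<le> norm x" if "x \<in> M" for x
      using contractionsD(2)[OF Z that] contractionsD(2)[OF Zs bopsD(1)[OF Zb that]]
      by (simp add: B_def)
    show "B x \<in> M" if "x \<in> M" for x
      using bopsD(1)[OF contractionsD(1)[OF Zs] bopsD(1)[OF Zb that]] by (simp add: B_def)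
    show "B x = 0" if "x \<notin> M" for x
      using bopsD(2)[OF Zb that] bops_linear(1)[OF contractionsD(1)[OF Zs] N]
      by (simp add: B_def)
  qed (rule selfadj)
  from sqrt_op_props[OF M this selfadj]
  have *: "defect M N Z \<in> bops M M" "positive_op M (defect M N Z)"
    "\<And>x. x \<in> M \<Longrightarrow> defect M N Z (defect M N Z x) = x - B x"
    unfolding defect_def B_def by auto
  then show "defect M N Z \<in> bops M M" by blast
  show sa: "cinner (defect M N Z x) y = cinner x (defect M N Z y)" if "x \<in> M" "y \<in> M" for x y
    using positive_op_selfadjoint[OF M *(1,2) that] .
  show "(norm (defect M N Z x))\<^sup>2 = (norm x)\<^sup>2 - (norm (Z x))\<^sup>2" if x: "x \<in> M" for x
  proof -
    have "cinner (defect M N Z x) (defect M N Z x) = cinner x (x - B x)"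
      using sa[OF x bopsD(1)[OF *(1) x]] *(3)[OF x] by simp
    also have "cinner x (B x) = cinner (Z x) (Z x)"
      using op_adj_cinner[OF M N Zb x bopsD(1)[OF Zb x]] by (simp add: B_def)
    then have "cinner x (x - B x) = cinner x x - cinner (Z x) (Z x)"
      by (simp add: cinner_simps)
    finally show ?thesis by (simp add: norm_sq_cinner)
  qed
qed

lemma defect_contraction:
  assumes "closed_csubspace M" "closed_csubspace N" "Z \<in> contractions M N"
  shows "defect M N Z \<in> contractions M M"
proof -
  have "norm (defect M N Z x) \<le> norm x" if "x \<in> M" for x
    by (rule power2_le_imp_le) (use norm_defect[OF assms that] in auto)
  then show ?thesis using defect_bops[OF assms] by (simp add: contractions_def)
qed

section \<open>Factorisation through a dominating operator\<close>

lemma csubspace_closure_image: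
  assumes P: "closed_csubspace P" and A: "A \<in> bops P N"
  shows "closed_csubspace (closure (A ` P))"
proof (rule csubspace_closure)
  show "0 \<in> A ` P"
    using bops_linear(1)[OF A P] csubspaceD(2)[OF P] by force
  show "x + y \<in> A ` P" if "x \<in> A ` P" "y \<in> A ` P" for x y
    using that csubspaceD(3)[OF P] bopsD(3)[OF A, symmetric] by auto
  show "c *\<^sub>C x \<in> A ` P" if "x \<in> A ` P" for c x
    using that csubspaceD(4)[OF P] bopsD(4)[OF A, symmetric] by auto
qed

lemma bops_closure_eqI:
  assumes "X \<in> bops (closure S) N" "Y \<in> bops (closure S) N" "closed_csubspace (closure S)"
    and eq: "\<And>u. u \<in> S \<Longrightarrow> X u = Y u"
  shows "X = Y"
proof
  fix u show "X u = Y u"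
  proof (cases "u \<in> closure S")
    case True
    then obtain s where s: "\<forall>n. s n \<in> S" "s \<longlonglongrightarrow> u" by (auto simp: closure_sequential)
    then have sc: "\<And>n. s n \<in> closure S" using closure_subset by blast
    show ?thesis
      using bops_tendsto[OF assms(1,3) sc s(2)] bops_tendsto[OF assms(2,3) sc s(2)] s(1) eq
      by (auto intro: LIMSEQ_unique)
  qed (use assms bopsD(2) in metis)
qed

text \<open>Douglas-type factorisation: an operator dominated in norm by \<open>A\<close> factors through \<open>A\<close> by a
  contraction. The factor is determined on the range of \<open>A\<close> and extends by uniform continuity.\<close>

lemma contraction_factor_exists:
  assumes P: "closed_csubspace P" and N: "closed_csubspace N"
    and A: "A \<in> bops P Q" and G: "G \<in> bops P N"
    and le: "\<And>x. x \<in> P \<Longrightarrow> norm (G x) \<le> norm (A x)"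
  shows "\<exists>X \<in> contractions (closure (A ` P)) N. \<forall>x\<in>P. X (A x) = G x"
proof -
  note AL = bops_linear[OF A P] and GL = bops_linear[OF G P]
  define f where "f u = G (SOME x. x \<in> P \<and> A x = u)" for u
  have G_le: "norm (G x - G y) \<le> norm (A x - A y)" if "x \<in> P" "y \<in> P" for x y
    using le[OF csubspaceD(6)[OF P that]] that by (simp add: AL GL)
  have fA: "f (A x) = G x" if "x \<in> P" for x
  proof -
    define z where "z = (SOME z. z \<in> P \<and> A z = A x)"
    have "z \<in> P \<and> A z = A x"
      unfolding z_def by (rule someI[of _ x]) (use that in simp)
    then show ?thesis using G_le[of z x] that by (simp add: f_def z_def[symmetric])
  qed
  have "dist (f u) (f v) \<le> dist u v" if "u \<in> A ` P" "v \<in> A ` P" for u v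
    using that fA G_le by (auto simp: dist_norm)
  then have "uniformly_continuous_on (A ` P) f"
    unfolding uniformly_continuous_on_def by (metis order_le_less_trans)
  then obtain g where g: "uniformly_continuous_on (closure (A ` P)) g"
    and gf: "\<And>u. u \<in> A ` P \<Longrightarrow> f u = g u"
    by (rule uniformly_continuous_on_extension_on_closure) blast
  have gA: "g (A x) = G x" if "x \<in> P" for x
    using gf[of "A x"] fA that by simp
  have cl: "closed_csubspace (closure (A ` P))" by (rule csubspace_closure_image[OF P A])
  note CD = csubspaceD[OF cl]
  have g_tendsto: "(\<lambda>n. G (p n)) \<longlonglongrightarrow> g u"
    if p: "\<And>n. p n \<in> P" and u: "(\<lambda>n. A (p n)) \<longlonglongrightarrow> u" for p u
  proof -
    have in_cl: "\<forall>n. A (p n) \<in> closure (A ` P)" using p closure_subset by blast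
    then have "u \<in> closure (A ` P)" using closed_sequentially[OF closed_closure _ u] by blast
    then have "(\<lambda>n. g (A (p n))) \<longlonglongrightarrow> g u"
      using in_cl by (intro continuous_on_tendsto_compose[OF uniformly_continuous_imp_continuous[OF g] u]) simp_all
    then show ?thesis using gA p by simp
  qed
  have approx: "\<exists>p. (\<forall>n. p n \<in> P) \<and> (\<lambda>n. A (p n)) \<longlonglongrightarrow> u \<and> (\<lambda>n. G (p n)) \<longlonglongrightarrow> g u"
    if u: "u \<in> closure (A ` P)" for u
  proof -
    obtain s where s: "\<forall>n. s n \<in> A ` P" "s \<longlonglongrightarrow> u" using u by (auto simp: closure_sequential)
    then have "\<forall>n. \<exists>x\<in>P. s n = A x" by blast
    then obtain p where p: "\<And>n. p n \<in> P" "\<And>n. s n = A (p n)" by metis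
    have "s = (\<lambda>n. A (p n))" using p(2) by blast
    then show ?thesis using g_tendsto[of p u] p(1) s(2) by (intro exI[of _ p]) simp
  qed
  have g_lim: "g u = l"
    if "\<And>n. p n \<in> P" "(\<lambda>n. A (p n)) \<longlonglongrightarrow> u" "(\<lambda>n. G (p n)) \<longlonglongrightarrow> l" for p u l
    by (rule LIMSEQ_unique[OF g_tendsto[OF that(1,2)] that(3)])
  define X where "X u = (if u \<in> closure (A ` P) then g u else 0)" for u
  have XN: "X u \<in> N" if u: "u \<in> closure (A ` P)" for u
  proof -
    obtain p where "\<forall>n. p n \<in> P" and lim: "(\<lambda>n. G (p n)) \<longlonglongrightarrow> g u" using approx[OF u] by blast
    then have "\<And>n. G (p n) \<in> N" using bopsD(1)[OF G] by blast
    from closed_sequentially[OF csubspaceD(1)[OF N] this lim] show ?thesis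
      using u by (simp add: X_def)
  qed
  have Xle: "norm (X u) \<le> norm u" if u: "u \<in> closure (A ` P)" for u
  proof -
    obtain p where p: "\<forall>n. p n \<in> P" "(\<lambda>n. A (p n)) \<longlonglongrightarrow> u" "(\<lambda>n. G (p n)) \<longlonglongrightarrow> g u"
      using approx[OF u] by blast
    show ?thesis
      using LIMSEQ_le[OF tendsto_norm[OF p(3)] tendsto_norm[OF p(2)]] p(1) le u
      by (auto simp: X_def)
  qed
  have Xadd: "X (u + v) = X u + X v" if u: "u \<in> closure (A ` P)" and v: "v \<in> closure (A ` P)" for u v
  proof -
    obtain p q where p: "\<And>n. p n \<in> P" "(\<lambda>n. A (p n)) \<longlonglongrightarrow> u" "(\<lambda>n. G (p n)) \<longlonglongrightarrow> g u"
      and q: "\<And>n. q n \<in> P" "(\<lambda>n. A (q n)) \<longlonglongrightarrow> v" "(\<lambda>n. G (q n)) \<longlonglongrightarrow> g v"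
      using approx[OF u] approx[OF v] by blast
    have "g (u + v) = g u + g v"
      by (rule g_lim[of "\<lambda>n. p n + q n"])
        (use p q tendsto_add in \<open>auto simp: csubspaceD[OF P] bopsD[OF A] bopsD[OF G]\<close>)
    then show ?thesis using u v CD by (simp add: X_def)
  qed
  have Xscale: "X (c *\<^sub>C u) = c *\<^sub>C X u" if u: "u \<in> closure (A ` P)" for c u
  proof -
    obtain p where p: "\<And>n. p n \<in> P" "(\<lambda>n. A (p n)) \<longlonglongrightarrow> u" "(\<lambda>n. G (p n)) \<longlonglongrightarrow> g u"
      using approx[OF u] by blast
    have "g (c *\<^sub>C u) = c *\<^sub>C g u"
      by (rule g_lim[of "\<lambda>n. c *\<^sub>C p n"])
        (use p tendsto_scaleC in \<open>auto simp: csubspaceD[OF P] bopsD[OF A] bopsD[OF G]\<close>)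
    then show ?thesis using u CD by (simp add: X_def)
  qed
  have "\<exists>K. \<forall>u\<in>closure (A ` P). norm (X u) \<le> K * norm u"
    using Xle by (intro exI[of _ 1]) auto
  then have "X \<in> contractions (closure (A ` P)) N"
    unfolding contractions_def bops_def using XN Xle Xadd Xscale by (simp add: X_def)
  moreover have "X (A x) = G x" if "x \<in> P" for x
    using gA[OF that] closure_subset[of "A ` P"] that by (auto simp: X_def)
  ultimately show ?thesis by blast
qed

lemma bops_restrict:
  assumes T: "T \<in> bops N Q" and M: "closed_csubspace M" "M \<subseteq> N"
  shows "(\<lambda>x. if x \<in> M then T x else 0) \<in> bops M Q"
proof -
  obtain K where "\<And>x. x \<in> N \<Longrightarrow> norm (T x) \<le> K * norm x" using bops_bound[OF T] by metis
  then have "\<exists>K. \<forall>x\<in>M. norm (if x \<in> M then T x else 0) \<le> K * norm x"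
    using M by (intro exI[of _ K]) auto
  then show ?thesis
    using bopsD[OF T] csubspaceD[OF M(1)] M(2) unfolding bops_def by (simp add: subset_iff)
qed

section \<open>Conjugations\<close>

lemma conjugationD:
  assumes "conjugation C"
  shows "C (x + y) = C x + C y" "C (c *\<^sub>C x) = cnj c *\<^sub>C C x" "norm (C x) = norm x"
    "C (C x) = x" "C (r *\<^sub>R x) = r *\<^sub>R C x" "C (x - y) = C x - C y"
proof -
  show add: "C (x + y) = C x + C y" for x y using assms by (simp add: conjugation_def)
  show "C (c *\<^sub>C x) = cnj c *\<^sub>C C x" "norm (C x) = norm x" "C (C x) = x"
    using assms by (auto simp: conjugation_def)
  have "C (of_real r *\<^sub>C x) = of_real r *\<^sub>C C x"
    using assms by (simp add: conjugation_def)
  then show "C (r *\<^sub>R x) = r *\<^sub>R C x" by (simp add: scaleC_of_real)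
  show "C (x - y) = C x - C y"
    using add[of "x - y" y] by simp
qed

text \<open>Polarisation turns the isometry property into this identity, whose arguments are exchanged
  because \<open>C\<close> is antilinear.\<close>

lemma conjugation_cinner:
  assumes C: "conjugation C"
  shows "cinner (C x) (C y) = cinner y x"
proof -
  note CD = conjugationD[OF C]
  have re: "Re (cinner (C u) (C v)) = Re (cinner u v)" for u v
    using norm_add_sq[of "C u" "C v"] norm_add_sq[of u v]
    by (simp add: CD(1)[symmetric] CD(3))
  have "cinner (C x) (C y) = cnj (cinner x y)"
  proof (rule complex_eqI)
    show "Im (cinner (C x) (C y)) = Im (cnj (cinner x y))"
      using re[of x "\<i> *\<^sub>C y"] by (simp add: CD cinner_simps)
  qed (simp add: re)
  then show ?thesis by (metis cinner_commute)
qed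

lemma conjugation_cinner_swap:
  assumes "conjugation C"
  shows "cinner (C x) y = cinner (C y) x"
  using conjugation_cinner[OF assms, of x "C y"] conjugationD(4)[OF assms] by simp

lemma csubspace_conjugation_image:
  assumes C: "conjugation C" and M: "closed_csubspace M"
  shows "closed_csubspace (C ` M)"
proof -
  note CD = conjugationD[OF C]
  have mem: "x \<in> C ` M \<longleftrightarrow> C x \<in> M" for x
    using CD(4) by (metis image_iff)
  have C0: "C 0 = 0" using CD(3)[of 0] by simp
  have "closed (C ` M)"
    unfolding closed_sequential_limits
  proof (intro allI impI)
    fix f l assume f: "(\<forall>n. f n \<in> C ` M) \<and> f \<longlonglongrightarrow> l"
    then have "(\<lambda>n. dist (f n) l) \<longlonglongrightarrow> 0" by (simp add: tendsto_dist_iff[symmetric])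
    moreover have "dist (C (f n)) (C l) = dist (f n) l" for n
      by (simp add: dist_norm CD(6)[symmetric] CD(3))
    ultimately have "(\<lambda>n. C (f n)) \<longlonglongrightarrow> C l"
      by (subst tendsto_dist_iff) simp
    then show "l \<in> C ` M"
      using f mem closed_sequentially[OF csubspaceD(1)[OF M], of "\<lambda>n. C (f n)"] by simp
  qed
  then show ?thesis
    unfolding closed_csubspace_def by (simp add: mem CD C0 csubspaceD[OF M])
qed

section \<open>Contractive extensions of a C-symmetric contraction\<close>

locale C_symmetric_contraction =
  fixes C :: "'h::complex_hilbert \<Rightarrow> 'h" and HV :: "'h set" and V :: "'h \<Rightarrow> 'h"
  assumes C: "conjugation C"
    and HV: "closed_csubspace HV"
    and V: "V \<in> contractions HV UNIV"
    and sym: "C_symmetric C HV V"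
begin

abbreviation "HVp \<equiv> UNIV \<ominus>\<^sub>H HV"
abbreviation "Vs \<equiv> op_adj HV UNIV V"
abbreviation "D \<equiv> DVstar HV V"
abbreviation "DD \<equiv> DVstar_space HV V"
abbreviation "L \<equiv> L0 C HV V"
abbreviation "Lp \<equiv> L0_perp C HV V"
abbreviation "X \<equiv> X0 C HV V"
abbreviation "Xs \<equiv> op_adj L HVp X"
abbreviation "DXs \<equiv> defect HVp L Xs"
abbreviation "DDXs \<equiv> defect_space HVp L Xs"

lemmas CD = conjugationD[OF C]

lemma HVp: "closed_csubspace HVp"
  by (rule csubspace_ominus[OF csubspace_UNIV])

lemmas V_bops = contractionsD(1)[OF V]

lemma Vs: "Vs \<in> contractions UNIV HV"
  by (rule op_adj_contraction[OF HV csubspace_UNIV V])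

lemma Vs_in_HV: "Vs y \<in> HV"
  by (rule bopsD(1)[OF contractionsD(1)[OF Vs] UNIV_I])

lemma D: "D \<in> contractions UNIV UNIV"
  unfolding DVstar_def by (rule defect_contraction[OF csubspace_UNIV HV Vs])

lemma D_selfadjoint: "cinner (D x) y = cinner x (D y)"
  unfolding DVstar_def by (rule defect_selfadjoint[OF csubspace_UNIV HV Vs UNIV_I UNIV_I])

lemma norm_D: "(norm (D x))\<^sup>2 = (norm x)\<^sup>2 - (norm (Vs x))\<^sup>2"
  unfolding DVstar_def by (rule norm_defect[OF csubspace_UNIV HV Vs UNIV_I])

lemmas D_bops = contractionsD(1)[OF D]
lemmas D_zero = bops_linear(1)[OF D_bops csubspace_UNIV]

lemma DD_eq: "DD = closure (range D)"
  by (simp add: DVstar_space_def defect_space_def DVstar_def)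

lemma DD: "closed_csubspace DD"
  unfolding DD_eq by (rule csubspace_closure_image[OF csubspace_UNIV D_bops])

lemma D_in_DD: "D x \<in> DD"
  unfolding DD_eq by (rule subsetD[OF closure_subset rangeI])

lemma CHV: "closed_csubspace (C ` HV)"
  by (rule csubspace_conjugation_image[OF C HV])

lemma D_restrict: "(\<lambda>x. if x \<in> C ` HV then D x else 0) \<in> bops (C ` HV) UNIV"
  by (rule bops_restrict[OF D_bops CHV subset_UNIV])

lemma L_eq: "L = closure ((\<lambda>x. if x \<in> C ` HV then D x else 0) ` C ` HV)"
  unfolding L0_def by (simp cong: image_cong_simp)

lemma L: "closed_csubspace L"
  unfolding L_eq by (rule csubspace_closure_image[OF CHV D_restrict])

lemma L_subset: "L \<subseteq> DD"
  unfolding L0_def DD_eq by (intro closure_mono) auto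

lemma D_C_in_L: "h \<in> HV \<Longrightarrow> D (C h) \<in> L"
  unfolding L0_def by (intro subsetD[OF closure_subset] imageI)

lemma Lp: "closed_csubspace Lp"
  unfolding L0_perp_def by (rule csubspace_ominus[OF DD])

lemma split_HV: "x = proj HV x + proj HVp x"
  by (rule proj_split[OF HV csubspace_UNIV subset_UNIV UNIV_I])

text \<open>This is how \<open>C\<close>-symmetry enters: the adjoint of \<open>V\<close> is known on \<open>C HV\<close>.\<close>

lemma Vs_C: "h \<in> HV \<Longrightarrow> Vs (C h) = proj HV (C (V h))"
proof (rule proj_eqI[OF HV, symmetric])
  assume h: "h \<in> HV"
  show "Vs (C h) \<in> HV" by (rule Vs_in_HV)
  show "cinner m (Vs (C h)) = cinner m (C (V h))" if "m \<in> HV" for m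
    using op_adj_cinner[OF HV csubspace_UNIV V_bops that, of "C h"] sym that h
    by (simp add: C_symmetric_def)
qed

text \<open>The prescription for \<open>X0\<close> is norm decreasing because the two parts of \<open>C V h\<close> have
  squared norms adding up to at most \<open>\<parallel>h\<parallel>\<^sup>2\<close>, and the part in \<open>HV\<close> is \<open>V\<^sup>* C h\<close>.\<close>

lemma X0_props:
  shows X: "X \<in> contractions L HVp"
    and X_D_C: "\<And>h. h \<in> HV \<Longrightarrow> X (D (C h)) = proj HVp (C (V h))"
proof -
  define A where "A x = (if x \<in> C ` HV then D x else 0)" for x
  define G where "G z = (if z \<in> C ` HV then proj HVp (C (V (C z))) else 0)" for z
  have A: "A \<in> bops (C ` HV) UNIV" unfolding A_def by (rule D_restrict)
  have Leq: "L = closure (A ` C ` HV)" unfolding A_def by (rule L_eq)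
  have mem: "x \<in> C ` HV \<longleftrightarrow> C x \<in> HV" for x
    using CD(4) by (metis image_iff)
  have le: "norm (G z) \<le> norm (A z)" if z: "z \<in> C ` HV" for z
  proof -
    have h: "C z \<in> HV" using z mem by blast
    have "(norm (G z))\<^sup>2 = (norm (V (C z)))\<^sup>2 - (norm (Vs z))\<^sup>2"
      using norm_proj_split[OF HV, of "C (V (C z))"] Vs_C[OF h] z
      by (simp add: G_def CD)
    also have "(norm (V (C z)))\<^sup>2 \<le> (norm z)\<^sup>2"
      using contractionsD(2)[OF V h] by (simp add: CD)
    finally have "(norm (G z))\<^sup>2 \<le> (norm (A z))\<^sup>2"
      using z by (simp add: A_def norm_D)
    then show ?thesis by (rule power2_le_imp_le) simp
  qed
  have "norm (G z) \<le> 1 * norm z" if z: "z \<in> C ` HV" for z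
    using le[OF z] contractionsD(2)[OF D, of z] z by (simp add: A_def)
  then have "\<exists>K. \<forall>z\<in>C ` HV. norm (G z) \<le> K * norm z" by blast
  then have G: "G \<in> bops (C ` HV) HVp"
    unfolding bops_def G_def
    by (auto simp: mem CD csubspaceD[OF HV] bopsD[OF V_bops] proj_add[OF HVp]
        proj_scaleC[OF HVp] proj_in[OF HVp])
  obtain Y where Y: "Y \<in> contractions L HVp" and YA: "\<forall>z\<in>C ` HV. Y (A z) = G z"
    using contraction_factor_exists[OF CHV HVp A G le] Leq by auto
  have YD: "Y (D (C h)) = proj HVp (C (V h))" if "h \<in> HV" for h
    using YA that by (auto simp: A_def G_def CD)
  have "X = Y"
    unfolding X0_def
  proof (rule the_equality)
    show "Y \<in> bops L HVp \<and> (\<forall>h\<in>HV. Y (D (C h)) = proj HVp (C (V h)))"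
      using contractionsD(1)[OF Y] YD by blast
    fix Y' assume Y': "Y' \<in> bops L HVp \<and> (\<forall>h\<in>HV. Y' (D (C h)) = proj HVp (C (V h)))"
    show "Y' = Y"
      by (rule bops_closure_eqI[of _ "D ` C ` HV"])
        (use Y' contractionsD(1)[OF Y] YD L in \<open>auto simp: L0_def\<close>)
  qed
  then show "X \<in> contractions L HVp" "\<And>h. h \<in> HV \<Longrightarrow> X (D (C h)) = proj HVp (C (V h))"
    using Y YD by auto
qed

lemmas X_bops = contractionsD(1)[OF X]

lemma Xs: "Xs \<in> contractions HVp L"
  by (rule op_adj_contraction[OF L HVp X])

text \<open>What the proof uses of \<open>K = Xt\<^sup>*\<close> and \<open>G = Xt\<close>, for a contractive extension \<open>Xt\<close> of \<open>X0\<close>.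
  Everything is tested on the range of \<open>D\<close> only, so that the pair \<open>(Xs, X \<circ> proj L)\<close> satisfies it
  literally, without a restriction of \<open>X \<circ> proj L\<close> to \<open>DD\<close>.\<close>

definition extension_pair :: "('h \<Rightarrow> 'h) \<Rightarrow> ('h \<Rightarrow> 'h) \<Rightarrow> bool"
  where "extension_pair K G \<longleftrightarrow>
    (\<forall>x\<in>HVp. \<forall>y. cinner (K x) (D y) = cinner x (G (D y))) \<and>
    (\<forall>y. G (D y) \<in> HVp \<and> norm (G (D y)) \<le> norm (D y)) \<and>
    (\<forall>h\<in>HV. G (D (C h)) = proj HVp (C (V h)))"

lemma extension_pair_adjoint:
  assumes Xt: "Xt \<in> contractions DD HVp" and ext: "extends_on L X Xt"
  shows "extension_pair (op_adj DD HVp Xt) Xt"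
  unfolding extension_pair_def
proof (intro conjI allI ballI)
  note Xtb = contractionsD(1)[OF Xt]
  show "cinner (op_adj DD HVp Xt x) (D y) = cinner x (Xt (D y))" if "x \<in> HVp" for x y
    by (rule op_adj_cinner_left[OF DD HVp Xtb D_in_DD that])
  show "Xt (D y) \<in> HVp" for y by (rule bopsD(1)[OF Xtb D_in_DD])
  show "norm (Xt (D y)) \<le> norm (D y)" for y by (rule contractionsD(2)[OF Xt D_in_DD])
  show "Xt (D (C h)) = proj HVp (C (V h))" if "h \<in> HV" for h
    using ext D_C_in_L[OF that] X_D_C[OF that] by (simp add: extends_on_def)
qed

lemma extension_pair_minimal: "extension_pair Xs (X \<circ> proj L)"
  unfolding extension_pair_def comp_def
proof (intro conjI allI ballI)
  show "cinner (Xs x) (D y) = cinner x (X (proj L (D y)))" if x: "x \<in> HVp" for x y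
  proof -
    have "Xs x \<in> L" using bopsD(1)[OF contractionsD(1)[OF Xs] x] .
    then have "cinner (Xs x) (D y) = cinner (Xs x) (proj L (D y))"
      by (rule proj_cinner[OF L, symmetric])
    then show ?thesis
      using op_adj_cinner_left[OF L HVp X_bops proj_in[OF L] x] by simp
  qed
  show "X (proj L (D y)) \<in> HVp" for y by (rule bopsD(1)[OF X_bops proj_in[OF L]])
  show "norm (X (proj L (D y))) \<le> norm (D y)" for y
    using contractionsD(2)[OF X proj_in[OF L]] norm_proj_le[OF L] order_trans by blast
  show "X (proj L (D (C h))) = proj HVp (C (V h))" if "h \<in> HV" for h
    using proj_id[OF L D_C_in_L[OF that]] X_D_C[OF that] by simp
qed

text \<open>The adjoint \<open>V\<^sup>* + G D\<close> has orthogonal summands, so its norm is controlled by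
  \<open>\<parallel>V\<^sup>* y\<parallel>\<^sup>2 + \<parallel>D y\<parallel>\<^sup>2 = \<parallel>y\<parallel>\<^sup>2\<close>.\<close>

lemma V_ext_props:
  assumes pair: "extension_pair K G"
  shows V_ext_contraction: "V_ext HV V K \<in> contractions UNIV UNIV"
    and V_ext_adjoint: "op_adj UNIV UNIV (V_ext HV V K) y = Vs y + G (D y)"
proof -
  define T where "T y = Vs y + G (D y)" for y
  have GHVp: "G (D y) \<in> HVp" for y using pair by (simp add: extension_pair_def)
  have adj: "cinner (T y) x = cinner y (V_ext HV V K x)" for x y
  proof -
    have z: "proj HVp x \<in> HVp" by (rule proj_in[OF HVp])
    have "cinner (T y) x = cinner (Vs y) (proj HV x) + cinner (G (D y)) (proj HVp x)"
      by (simp add: T_def cinner_simps proj_cinner[OF HV Vs_in_HV] proj_cinner[OF HVp GHVp])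
    also have "cinner (Vs y) (proj HV x) = cinner y (V (proj HV x))"
      by (rule op_adj_cinner_left[OF HV csubspace_UNIV V_bops proj_in[OF HV] UNIV_I])
    also have "cinner (G (D y)) (proj HVp x) = cinner (D y) (K (proj HVp x))"
      using pair z unfolding extension_pair_def by (metis cinner_commute)
    finally show ?thesis by (simp add: V_ext_def cinner_simps D_selfadjoint)
  qed
  have T_le: "norm (T y) \<le> norm y" for y
  proof (rule power2_le_imp_le)
    have "(norm (T y))\<^sup>2 = (norm (Vs y))\<^sup>2 + (norm (G (D y)))\<^sup>2"
      unfolding T_def by (rule norm_add_orthogonal_sq[OF ominus_cinner(1)[OF Vs_in_HV GHVp]])
    also have "\<dots> \<le> (norm (Vs y))\<^sup>2 + (norm (D y))\<^sup>2"
      using pair by (simp add: extension_pair_def power_mono)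
    finally show "(norm (T y))\<^sup>2 \<le> (norm y)\<^sup>2" by (simp add: norm_D)
  qed simp
  show V_ext: "V_ext HV V K \<in> contractions UNIV UNIV"
    by (rule contraction_from_adjoint[OF csubspace_UNIV csubspace_UNIV T_le _ _ adj]) auto
  have "cinner (V_ext HV V K x) y = cinner x (T y)" for x y
    using adj by (metis cinner_commute)
  then have "op_adj UNIV UNIV (V_ext HV V K) = T"
    by (intro op_adj_eqI[OF csubspace_UNIV csubspace_UNIV contractionsD(1)[OF V_ext]]) auto
  then show "op_adj UNIV UNIV (V_ext HV V K) y = Vs y + G (D y)"
    by (simp add: T_def)
qed

lemma D_K_zero:
  assumes pair: "extension_pair K G"
  shows "D (K 0) = 0"
proof -
  have "cinner (D (K 0)) y = 0" for y
    using pair csubspaceD(2)[OF HVp] by (simp add: extension_pair_def D_selfadjoint)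
  then have "cinner (D (K 0)) (D (K 0)) = 0" by blast
  then show ?thesis by (simp add: cinner_self_norm)
qed

text \<open>On \<open>HV\<close> the two terms \<open>V\<^sup>* C h\<close> and \<open>G D C h\<close> are the two components of \<open>C V h\<close>.\<close>

lemma conj_adjoint_V_ext:
  assumes pair: "extension_pair K G" and h: "h \<in> HV"
  shows "C (op_adj UNIV UNIV (V_ext HV V K) (C h)) = V h"
proof -
  have "op_adj UNIV UNIV (V_ext HV V K) (C h) = proj HV (C (V h)) + proj HVp (C (V h))"
    using pair h by (simp add: V_ext_adjoint[OF pair] Vs_C extension_pair_def)
  then show ?thesis using split_HV[of "C (V h)"] CD(4) by simp
qed

lemma V_ext_extends:
  assumes pair: "extension_pair K G" and h: "h \<in> HV"
  shows "V_ext HV V K h = V h"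
proof -
  have "proj HVp h = 0"
    by (rule proj_perp[OF HVp]) (rule ominus_cinner(2)[OF h])
  then show ?thesis by (simp add: V_ext_def proj_id[OF HV h] D_K_zero[OF pair])
qed

text \<open>With \<open>T\<close> short for \<open>V_ext HV V K\<close>, the adjoint of the average of \<open>T\<close> and \<open>C T\<^sup>* C\<close> is the
  average of \<open>T\<^sup>*\<close> and \<open>C T C\<close>. Conjugating the latter by \<open>C\<close> gives the former back.\<close>

lemma W_ext_props:
  assumes pair: "extension_pair K G"
  shows "W_ext C HV V K \<in> contractions UNIV UNIV" "C_selfadjoint C (W_ext C HV V K)"
    "extends_on HV V (W_ext C HV V K)"
proof -
  define T where "T = V_ext HV V K"
  define Ts where "Ts = op_adj UNIV UNIV T"
  define W where "W = W_ext C HV V K"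
  define Ws where "Ws x = (1/2) *\<^sub>R (Ts x + C (T (C x)))" for x
  have T: "T \<in> contractions UNIV UNIV" unfolding T_def by (rule V_ext_contraction[OF pair])
  have Ts: "Ts \<in> contractions UNIV UNIV"
    unfolding Ts_def by (rule op_adj_contraction[OF csubspace_UNIV csubspace_UNIV T])
  have Weq: "W x = (1/2) *\<^sub>R (T x + C (Ts (C x)))" for x
    by (simp add: W_def W_ext_def T_def Ts_def)
  have TTs: "cinner (Ts y) x = cinner y (T x)" for x y
    unfolding Ts_def
    by (rule op_adj_cinner_left[OF csubspace_UNIV csubspace_UNIV contractionsD(1)[OF T]]) auto
  have adj: "cinner (Ws x) y = cinner x (W y)" for x y
  proof -
    have "cinner (C (T (C x))) y = cinner (C y) (T (C x))"
      by (rule conjugation_cinner_swap[OF C])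
    also have "\<dots> = cinner (Ts (C y)) (C x)" by (rule TTs[symmetric])
    also have "\<dots> = cinner x (C (Ts (C y)))"
      using conjugation_cinner[OF C, of "C (Ts (C y))" x] by (simp add: CD)
    finally show ?thesis by (simp add: Ws_def Weq cinner_simps TTs)
  qed
  have Ws_le: "norm (Ws x) \<le> norm x" for x
  proof -
    have "norm (Ts x + C (T (C x))) \<le> norm (Ts x) + norm (C (T (C x)))"
      by (rule norm_triangle_ineq)
    also have "\<dots> \<le> norm x + norm x"
      using contractionsD(2)[OF T, of "C x"] contractionsD(2)[OF Ts, of x] by (simp add: CD)
    finally show ?thesis by (simp add: Ws_def)
  qed
  show W: "W_ext C HV V K \<in> contractions UNIV UNIV"
    unfolding W_def[symmetric]
    by (rule contraction_from_adjoint[OF csubspace_UNIV csubspace_UNIV Ws_le _ _ adj]) auto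
  have "cinner (W x) y = cinner x (Ws y)" for x y
    using adj by (metis cinner_commute)
  then have Wadj: "op_adj UNIV UNIV W = Ws"
    by (intro op_adj_eqI[OF csubspace_UNIV csubspace_UNIV contractionsD(1)[OF W[folded W_def]]])
      auto
  have "W = C \<circ> Ws \<circ> C"
    by (rule ext) (simp add: Ws_def Weq CD add.commute)
  then show "C_selfadjoint C (W_ext C HV V K)"
    using contractionsD(1)[OF W] Wadj by (simp add: C_selfadjoint_def W_def)
  have "W h = V h" if "h \<in> HV" for h
    using conj_adjoint_V_ext[OF pair that] V_ext_extends[OF pair that]
    by (simp add: Weq T_def Ts_def flip: scaleR_2)
  then show "extends_on HV V (W_ext C HV V K)" by (simp add: extends_on_def W_def)
qed

text \<open>For an extension \<open>W\<close> the component of \<open>W\<^sup>* x\<close> in \<open>HV\<close> is \<open>V\<^sup>* x\<close>, which leaves for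
  the other component at most \<open>\<parallel>D x\<parallel>\<close>. It therefore factors through \<open>D\<close>, and the factor is
  the contraction sought; here \<open>W\<close> itself is \<open>V_ext\<close> of the adjoint of that factor.\<close>

lemma selfadjoint_extension_factor:
  assumes W: "W \<in> contractions UNIV UNIV" and sa: "C_selfadjoint C W" and ext: "extends_on HV V W"
  shows "\<exists>Xt \<in> contractions DD HVp. extends_on L X Xt \<and> W = W_ext C HV V (op_adj DD HVp Xt)"
proof -
  note Wb = contractionsD(1)[OF W]
  define Ws where "Ws = op_adj UNIV UNIV W"
  have Ws: "Ws \<in> contractions UNIV UNIV"
    unfolding Ws_def by (rule op_adj_contraction[OF csubspace_UNIV csubspace_UNIV W])
  have CWsC: "C (Ws (C x)) = W x" for x
    using sa unfolding C_selfadjoint_def Ws_def by (metis comp_apply)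
  have PWs: "proj HV (Ws x) = Vs x" for x
  proof (rule proj_eqI[OF HV])
    show "Vs x \<in> HV" by (rule Vs_in_HV)
    show "cinner m (Vs x) = cinner m (Ws x)" if "m \<in> HV" for m
      using op_adj_cinner[OF HV csubspace_UNIV V_bops that, of x]
        op_adj_cinner[OF csubspace_UNIV csubspace_UNIV Wb, of m x] ext that
      by (simp add: Ws_def extends_on_def)
  qed
  define G where "G x = proj HVp (Ws x)" for x
  have G_le: "norm (G x) \<le> norm (D x)" for x
  proof (rule power2_le_imp_le)
    have "(norm (Vs x))\<^sup>2 + (norm (G x))\<^sup>2 = (norm (Ws x))\<^sup>2"
      using norm_proj_split[OF HV, of "Ws x"] by (simp add: PWs G_def)
    also have "\<dots> \<le> (norm x)\<^sup>2" using contractionsD(2)[OF Ws] by simp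
    finally show "(norm (G x))\<^sup>2 \<le> (norm (D x))\<^sup>2" by (simp add: norm_D)
  qed simp
  have "norm (G x) \<le> 1 * norm x" for x
    using G_le[of x] contractionsD(2)[OF D, of x] by simp
  then have "\<exists>K. \<forall>x\<in>UNIV. norm (G x) \<le> K * norm x" by blast
  then have G: "G \<in> bops UNIV HVp"
    by (simp add: bops_def G_def bopsD[OF contractionsD(1)[OF Ws]] proj_add[OF HVp]
        proj_scaleC[OF HVp] proj_in[OF HVp])
  obtain Xt where Xt: "Xt \<in> contractions DD HVp" and XtD: "\<And>x. Xt (D x) = G x"
    using contraction_factor_exists[OF csubspace_UNIV HVp D_bops G G_le] unfolding DD_eq by auto
  have Xt_L: "(\<lambda>u. if u \<in> L then Xt u else 0) = X"
  proof (rule bops_closure_eqI[of _ "D ` C ` HV", folded L0_def])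
    show "(\<lambda>u. if u \<in> L then Xt u else 0) \<in> bops L HVp"
      by (rule bops_restrict[OF contractionsD(1)[OF Xt] L L_subset])
    fix u assume "u \<in> D ` C ` HV"
    then obtain h where h: "h \<in> HV" "u = D (C h)" by blast
    have "Ws (C h) = C (V h)"
      using CWsC[of h] ext h by (metis CD(4) extends_on_def)
    then show "(if u \<in> L then Xt u else 0) = X u"
      using h X_D_C D_C_in_L by (simp add: XtD G_def)
  qed (rule X_bops L)+
  have Xt_ext: "extends_on L X Xt"
    unfolding extends_on_def
  proof
    show "Xt u = X u" if "u \<in> L" for u using fun_cong[OF Xt_L, of u] that by simp
  qed
  define K where "K = op_adj DD HVp Xt"
  have pair: "extension_pair K Xt"
    unfolding K_def by (rule extension_pair_adjoint[OF Xt Xt_ext])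
  have "op_adj UNIV UNIV (V_ext HV V K) y = Ws y" for y
    unfolding V_ext_adjoint[OF pair] XtD G_def PWs[symmetric] by (rule split_HV[symmetric])
  then have adj: "op_adj UNIV UNIV (V_ext HV V K) = Ws" ..
  then have "V_ext HV V K = op_adj UNIV UNIV Ws"
    using op_adj_op_adj[OF csubspace_UNIV csubspace_UNIV contractionsD(1)[OF V_ext_contraction[OF pair]]]
    by simp
  also have "\<dots> = W"
    unfolding Ws_def by (rule op_adj_op_adj[OF csubspace_UNIV csubspace_UNIV Wb])
  finally have VW: "V_ext HV V K = W" .
  have "W_ext C HV V K x = W x" for x
    by (simp add: W_ext_def VW Ws_def[symmetric] CWsC flip: scaleR_2)
  then have "W_ext C HV V K = W" ..
  then show ?thesis using Xt Xt_ext unfolding K_def by blast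
qed

section \<open>Explicit formulas\<close>

text \<open>Both \<open>T = V_ext HV V K\<close> and \<open>C T\<^sup>* C\<close> agree with \<open>V\<close> on \<open>HV\<close>, so that \<open>K\<close> and \<open>G\<close> act on
  the component of \<open>x\<close> in \<open>HVp\<close> only.\<close>

lemma W_ext_formula:
  assumes pair: "extension_pair K G"
  shows "W_ext C HV V K x = V (proj HV x) + (1/2) *\<^sub>R (D (K (proj HVp x))
    + C (Vs (C (proj HVp x))) + C (G (D (C (proj HVp x)))))"
proof -
  define Ts where "Ts = op_adj UNIV UNIV (V_ext HV V K)"
  define p z where "p = proj HV x" and "z = proj HVp x"
  have Ts: "Ts \<in> bops UNIV UNIV"
    unfolding Ts_def
    by (rule op_adj_bops[OF csubspace_UNIV csubspace_UNIV contractionsD(1)[OF V_ext_contraction[OF pair]]])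
  have "C (Ts (C x)) = C (Ts (C p)) + C (Ts (C z))"
    by (subst split_HV[of x]) (simp add: CD bopsD[OF Ts] p_def z_def)
  also have "C (Ts (C p)) = V p"
    unfolding Ts_def p_def by (rule conj_adjoint_V_ext[OF pair proj_in[OF HV]])
  also have "C (Ts (C z)) = C (Vs (C z)) + C (G (D (C z)))"
    by (simp add: Ts_def V_ext_adjoint[OF pair] CD)
  finally have "W_ext C HV V K x
      = (1/2) *\<^sub>R (V p + D (K z) + (V p + (C (Vs (C z)) + C (G (D (C z))))))"
    by (simp add: W_ext_def V_ext_def Ts_def p_def z_def)
  also have "V p + D (K z) + (V p + (C (Vs (C z)) + C (G (D (C z)))))
      = 2 *\<^sub>R V p + (D (K z) + C (Vs (C z)) + C (G (D (C z))))"
    by (simp add: scaleR_2)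
  finally show ?thesis
    by (simp add: scaleR_add_right p_def z_def)
qed

text \<open>The component of \<open>C D X0\<^sup>* z\<close> in \<open>HV\<close> is forced by the prescribed values of \<open>X0\<close>.
  This relation converts the two formulas for \<open>W0\<close> into each other.\<close>

lemma D_Xs_split:
  assumes z: "z \<in> HVp"
  shows "D (Xs z) = C (Vs (C z)) + C (proj HVp (C (D (Xs z))))"
proof -
  have "proj HV (C (D (Xs z))) = Vs (C z)"
  proof (rule proj_eqI[OF HV])
    show "Vs (C z) \<in> HV" by (rule Vs_in_HV)
    show "cinner f (Vs (C z)) = cinner f (C (D (Xs z)))" if f: "f \<in> HV" for f
    proof -
      have "cinner (C (D (Xs z))) f = cinner (C f) (D (Xs z))"
        by (rule conjugation_cinner_swap[OF C])
      also have "\<dots> = cinner (D (C f)) (Xs z)" by (rule D_selfadjoint[symmetric])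
      also have "\<dots> = cinner (X (D (C f))) z"
        by (rule op_adj_cinner[OF L HVp X_bops D_C_in_L[OF f] z, symmetric])
      also have "\<dots> = cinner (C (V f)) z"
        unfolding X_D_C[OF f] by (rule proj_cinner_left[OF HVp z])
      also have "\<dots> = cinner (C z) (V f)" by (rule conjugation_cinner_swap[OF C])
      also have "\<dots> = cinner (Vs (C z)) f"
        by (rule op_adj_cinner_left[OF HV csubspace_UNIV V_bops f UNIV_I, symmetric])
      finally show ?thesis by (metis cinner_commute)
    qed
  qed
  then have "C (D (Xs z)) = Vs (C z) + proj HVp (C (D (Xs z)))"
    using split_HV[of "C (D (Xs z))"] by simp
  then show ?thesis by (metis CD(1,4))
qed

lemma W0_formulas:
  shows "W_ext C HV V Xs x = V_ext HV V Xs x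
      + (1/2) *\<^sub>R (C ((X \<circ> proj L) (D (C (proj HVp x)))) - C (proj HVp (C (D (Xs (proj HVp x))))))"
    and "W_ext C HV V Xs x = V (proj HV x) + C (Vs (C (proj HVp x)))
      + (1/2) *\<^sub>R (C (proj HVp (C (D (Xs (proj HVp x))))) + C ((X \<circ> proj L) (D (C (proj HVp x)))))"
proof -
  define z where "z = proj HVp x"
  define a b c where "a = C (Vs (C z))" and "b = C (proj HVp (C (D (Xs z))))"
    and "c = C ((X \<circ> proj L) (D (C z)))"
  have "D (Xs z) = a + b"
    unfolding a_def b_def by (rule D_Xs_split) (simp add: z_def proj_in[OF HVp])
  then have W: "W_ext C HV V Xs x = V (proj HV x) + (1/2) *\<^sub>R ((a + b) + a + c)"
    and Ve: "V_ext HV V Xs x = V (proj HV x) + (a + b)"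
    using W_ext_formula[OF extension_pair_minimal, of x]
    by (simp_all add: z_def[symmetric] a_def[symmetric] c_def V_ext_def)
  have "a + b + a + c = 2 *\<^sub>R a + (b + c)"
    by (simp add: scaleR_2 add_ac)
  then have "(1/2) *\<^sub>R (a + b + a + c) = a + (1/2) *\<^sub>R (b + c)"
    by (simp only: scaleR_add_right[of _ "2 *\<^sub>R a"]) simp
  then show W': "W_ext C HV V Xs x = V (proj HV x) + C (Vs (C (proj HVp x)))
      + (1/2) *\<^sub>R (C (proj HVp (C (D (Xs (proj HVp x))))) + C ((X \<circ> proj L) (D (C (proj HVp x)))))"
    unfolding W z_def[symmetric] a_def[symmetric] b_def[symmetric] c_def[symmetric]
    by (simp add: add.assoc)
  have "b + c = 2 *\<^sub>R b + (c - b)"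
    by (simp add: scaleR_2)
  then have "(1/2) *\<^sub>R (b + c) = b + (1/2) *\<^sub>R (c - b)"
    by (simp only: scaleR_add_right[of _ "2 *\<^sub>R b"]) simp
  then show "W_ext C HV V Xs x = V_ext HV V Xs x
      + (1/2) *\<^sub>R (C ((X \<circ> proj L) (D (C (proj HVp x)))) - C (proj HVp (C (D (Xs (proj HVp x))))))"
    unfolding W' Ve z_def[symmetric] a_def[symmetric] b_def[symmetric] c_def[symmetric]
    by (simp add: add.assoc)
qed

text \<open>Since \<open>DXs\<close> is self-adjoint, the adjoint of \<open>Xt\<close> is \<open>Xs + Ys DXs\<close>, where \<open>Ys\<close> is the adjoint
  of \<open>Yt\<close>. The terms that \<open>Yt\<close> contributes to \<open>W_ext_formula\<close> are thus \<open>R\<close> and \<open>C R\<^sup>* C\<close>.\<close>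

lemma W_ext_parametrised:
  assumes Xt: "Xt \<in> contractions DD HVp" and Yt: "Yt \<in> contractions Lp DDXs"
    and ext: "extends_on L X Xt"
    and Xt_eq: "\<And>u. u \<in> DD \<Longrightarrow> Xt u = X (proj L u) + DXs (Yt (proj Lp u))"
  defines "R \<equiv> D \<circ> op_adj Lp DDXs Yt \<circ> DXs"
  shows "W_ext C HV V (op_adj DD HVp Xt) x = W_ext C HV V Xs x
    + (1/2) *\<^sub>R (R (proj HVp x) + C (op_adj HVp UNIV R (C (proj HVp x))))"
proof -
  define Ys where "Ys = op_adj Lp DDXs Yt"
  define K where "K = op_adj DD HVp Xt"
  define z where "z = proj HVp x"
  have zH: "z \<in> HVp" unfolding z_def by (rule proj_in[OF HVp])
  note Ytb = contractionsD(1)[OF Yt]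
  have DXs: "DXs \<in> contractions HVp HVp" by (rule defect_contraction[OF HVp L Xs])
  note DXsb = contractionsD(1)[OF DXs] and DXs_sa = defect_selfadjoint[OF HVp L Xs]
  have DDXs: "closed_csubspace DDXs"
    unfolding defect_space_def by (rule csubspace_closure_image[OF HVp DXsb])
  have DXs_in: "DXs w \<in> DDXs" if "w \<in> HVp" for w
    unfolding defect_space_def by (rule subsetD[OF closure_subset imageI[OF that]])
  have DDXs_sub: "DDXs \<subseteq> HVp"
    unfolding defect_space_def
    by (rule closure_minimal) (use bopsD(1)[OF DXsb] csubspaceD(1)[OF HVp] in auto)
  have Ys: "Ys \<in> bops DDXs Lp" unfolding Ys_def by (rule op_adj_bops[OF Lp DDXs Ytb])
  have YtH: "Yt (proj Lp u) \<in> HVp" for u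
    using bopsD(1)[OF Ytb proj_in[OF Lp]] DDXs_sub by blast
  have Lp_sub: "Lp \<subseteq> DD" by (auto simp: L0_perp_def ominus_def)
  have Y_adj: "cinner (DXs (Yt (proj Lp u))) w = cinner u (Ys (DXs w))" if w: "w \<in> HVp" for u w
  proof -
    have "cinner (DXs (Yt (proj Lp u))) w = cinner (Yt (proj Lp u)) (DXs w)"
      by (rule DXs_sa[OF YtH w])
    also have "\<dots> = cinner (proj Lp u) (Ys (DXs w))"
      unfolding Ys_def by (rule op_adj_cinner[OF Lp DDXs Ytb proj_in[OF Lp] DXs_in[OF w]])
    also have "\<dots> = cinner u (Ys (DXs w))"
      by (rule proj_cinner_left[OF Lp bopsD(1)[OF Ys DXs_in[OF w]]])
    finally show ?thesis .
  qed
  have XsL: "Xs w \<in> L" if "w \<in> HVp" for w by (rule bopsD(1)[OF contractionsD(1)[OF Xs] that])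
  have Kz: "K z = Xs z + Ys (DXs z)"
  proof (rule eq_of_cinner_eq[OF DD])
    show "K z \<in> DD"
      unfolding K_def by (rule bopsD(1)[OF op_adj_bops[OF DD HVp contractionsD(1)[OF Xt]] zH])
    show "Xs z + Ys (DXs z) \<in> DD"
      using XsL[OF zH] L_subset bopsD(1)[OF Ys DXs_in[OF zH]] Lp_sub csubspaceD(3)[OF DD] by blast
    fix u assume u: "u \<in> DD"
    have "cinner u (K z) = cinner (Xt u) z"
      unfolding K_def by (rule op_adj_cinner[OF DD HVp contractionsD(1)[OF Xt] u zH, symmetric])
    also have "\<dots> = cinner (X (proj L u)) z + cinner (DXs (Yt (proj Lp u))) z"
      by (simp add: Xt_eq[OF u] cinner_simps)
    also have "cinner (X (proj L u)) z = cinner (proj L u) (Xs z)"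
      by (rule op_adj_cinner[OF L HVp X_bops proj_in[OF L] zH])
    also have "\<dots> = cinner u (Xs z)" by (rule proj_cinner_left[OF L XsL[OF zH]])
    finally show "cinner u (K z) = cinner u (Xs z + Ys (DXs z))"
      by (simp add: Y_adj[OF zH] cinner_simps)
  qed
  have R_eq: "R w = D (Ys (DXs w))" for w by (simp add: R_def Ys_def)
  define Rs where "Rs y = DXs (Yt (proj Lp (D y)))" for y
  have R_adj: "cinner (Rs y) w = cinner y (R w)" if "w \<in> HVp" for y w
    by (simp add: Rs_def R_eq Y_adj[OF that] D_selfadjoint)
  have "R \<in> contractions HVp UNIV"
  proof (rule contraction_from_adjoint[OF csubspace_UNIV HVp, of Rs])
    show "norm (Rs y) \<le> norm y" for y
      using contractionsD(2)[OF DXs YtH[of "D y"]] contractionsD(2)[OF Yt proj_in[OF Lp], of "D y"]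
        norm_proj_le[OF Lp, of "D y"] contractionsD(2)[OF D, of y]
      by (simp add: Rs_def)
    show "R w = 0" if "w \<notin> HVp" for w
      using that by (simp add: R_eq bopsD(2)[OF DXsb] bops_linear(1)[OF Ys DDXs] D_zero)
  qed (use R_adj in auto)
  then have "op_adj HVp UNIV R = Rs"
  proof (intro op_adj_eqI[OF HVp csubspace_UNIV])
    show "Rs y \<in> HVp" for y unfolding Rs_def by (rule bopsD(1)[OF DXsb YtH])
    show "cinner (R w) y = cinner w (Rs y)" if "w \<in> HVp" for w y
      using R_adj[OF that] by (metis cinner_commute)
  qed (auto simp: contractions_def)
  moreover have "Xt (D (C z)) = (X \<circ> proj L) (D (C z)) + Rs (C z)"
    by (simp add: Xt_eq[OF D_in_DD] Rs_def)
  moreover have "D (K z) = D (Xs z) + R z"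
    by (simp add: Kz R_eq bopsD[OF D_bops])
  ultimately show ?thesis
    using W_ext_formula[OF extension_pair_adjoint[OF Xt ext], of x]
      W_ext_formula[OF extension_pair_minimal, of x]
    by (simp add: K_def[symmetric] z_def[symmetric] CD scaleR_add_right)
qed

end

theorem theorem3p4:
  fixes C :: "'h::complex_hilbert \<Rightarrow> 'h" and HV :: "'h set" and V :: "'h \<Rightarrow> 'h"
  assumes C: "conjugation C"
    and HV: "closed_csubspace HV"
    and V: "V \<in> contractions HV UNIV"
    and sym: "C_symmetric C HV V"
  defines "HVp \<equiv> UNIV \<ominus>\<^sub>H HV"
    and "D \<equiv> DVstar HV V"
    and "DD \<equiv> DVstar_space HV V"
    and "L \<equiv> L0 C HV V"
    and "Lp \<equiv> L0_perp C HV V"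
    and "X \<equiv> X0 C HV V"
  defines "Vs \<equiv> op_adj HV UNIV V"
    and "Xs \<equiv> op_adj L HVp X"
  defines "DXs \<equiv> defect HVp L Xs"
    and "DDXs \<equiv> defect_space HVp L Xs"
    and "X0t \<equiv> X \<circ> proj L"
  defines "M \<equiv> \<lambda>Q. D \<circ> Q \<circ> DXs"
    and "W0 \<equiv> W_ext C HV V Xs"
  shows
    "(\<forall>W. W \<in> contractions UNIV UNIV \<and> C_selfadjoint C W \<and> extends_on HV V W \<longrightarrow>
        (\<exists>Xt \<in> contractions DD HVp. extends_on L X Xt \<and> W = W_ext C HV V (op_adj DD HVp Xt)))
   \<and> (\<forall>Xt \<in> contractions DD HVp. extends_on L X Xt \<longrightarrow>
        (let W = W_ext C HV V (op_adj DD HVp Xt)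
         in W \<in> contractions UNIV UNIV \<and> C_selfadjoint C W \<and> extends_on HV V W))
   \<and> (\<forall>x. W0 x = V_ext HV V Xs x
        + (1/2) *\<^sub>R (C (X0t (D (C (proj HVp x)))) - C (proj HVp (C (D (Xs (proj HVp x)))))))
   \<and> (\<forall>x. W0 x = V (proj HV x) + C (Vs (C (proj HVp x)))
        + (1/2) *\<^sub>R (C (proj HVp (C (D (Xs (proj HVp x))))) + C (X0t (D (C (proj HVp x))))))
   \<and> (\<forall>Xt \<in> contractions DD HVp. \<forall>Yt \<in> contractions Lp DDXs.
        extends_on L X Xt \<and> (\<forall>x\<in>DD. Xt x = X (proj L x) + DXs (Yt (proj Lp x))) \<longrightarrow>
        (let Ys = op_adj Lp DDXs Yt
         in \<forall>x. W_ext C HV V (op_adj DD HVp Xt) x = W0 x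
           + (1/2) *\<^sub>R (M Ys (proj HVp x) + C (op_adj HVp UNIV (M Ys) (C (proj HVp x))))))"
proof -
  interpret S: C_symmetric_contraction C HV V
    by unfold_locales (fact C HV V sym)+
  show ?thesis
    unfolding assms(5-17) Let_def
    using S.selfadjoint_extension_factor S.W_ext_props[OF S.extension_pair_adjoint]
      S.W0_formulas S.W_ext_parametrised
    by (intro conjI allI ballI impI) blast+
qed

end
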